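(* Let $\mathcal{A}$ be a locally $C^*$-algebra, let $\mathcal{H}$ be a Hilbert $\mathcal{A}$-module, let $X$ be a nonempty set and let $\mathbf{k}\colon X\times X\to\mathcal{L}^*(\mathcal{H})$ be a positive semidefinite kernel. Then for any $p\in S_*(\mathcal{A})$ and any $x\in X$ there exists a constant $c_p(x)\ge0$ such that for all $n\in\mathbb{N}$, $y_1,\dots,y_n\in X$, $h_1,\dots,h_n\in\mathcal{H}$, $$p\Bigl(\sum_{i,j=1}^n[\mathbf{k}(x,y_i)h_i,\mathbf{k}(x,y_j)h_j]_{\mathcal{H}}\Bigr)\le c_p(x)\,p\Bigl(\sum_{i,j=1}^n[\mathbf{k}(y_j,y_i)h_i,h_j]_{\mathcal{H}}\Bigr).$$
   Context: A locally $C^*$-algebra $\mathcal{A}$ is a complex $*$-algebra with a complete Hausdorff topology induced by a family of $C^*$-seminorms, i.e. seminorms $p$ with $p(a^*a)=p(a)^2$. $S_*(\mathcal{A})$ is the set of all continuous $C^*$-seminorms on $\mathcal{A}$. The positive elements of $\mathcal{A}$ are those of the form $a^*a$, and they define the order $\ge$. A Hilbert $\mathcal{A}$-module is a complex vector space and right $\mathcal{A}$-module $\mathcal{H}$ with a gramian $[\cdot,\cdot]\colon\mathcal{H}\times\mathcal{H}\to\mathcal{A}$, linear in the second variable, with $[x,y]=[y,x]^*$, $[x,x]\ge0$, $[x,x]=0$ iff $x=0$, and $[e,fa+gb]=[e,f]a+[e,g]b$ for $e,f,g\in\mathcal{H}$, $a,b\in\mathcal{A}$, which is complete in the topology given by the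 seminorms $\tilde p(h)=p([h,h])^{1/2}$, $p\in S_*(\mathcal{A})$. $\mathcal{L}^*(\mathcal{H})$ is the algebra of adjointable operators, i.e. linear $T\colon\mathcal{H}\to\mathcal{H}$ for which there is a linear $T^*$ with $[Th,k]=[h,T^*k]$ for all $h,k\in\mathcal{H}$. A kernel $\mathbf{k}$ is positive semidefinite if $\sum_{i,j=1}^n[\mathbf{k}(x_i,x_j)h_j,h_i]_{\mathcal{H}}\ge0$ for all $n\in\mathbb{N}$, $x_i\in X$, $h_i\in\mathcal{H}$. *)

theory Defs
  imports "HOL-Analysis.Analysis"
begin

section \<open>Topologies induced by seminorms, completeness\<close>

text \<open>Including \<^term>\<open>UNIV\<close> as a generator ensures that the topological space is the whole type
  even when \<open>P\<close> is empty (the induced topology is then the indiscrete one).\<close>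

definition seminorm_topology :: "('a::ab_group_add \<Rightarrow> real) set \<Rightarrow> 'a topology" where
  "seminorm_topology P =
     topology_generated_by (insert UNIV {{y. p (y - x) < e} |p x e. p \<in> P \<and> e > 0})"

text \<open>Completeness refers to the translation-invariant uniformity determined by a group topology:
  its basic entourages are \<open>{(x, y). x - y \<in> U}\<close> for the open neighbourhoods \<open>U\<close> of \<open>0\<close>.\<close>

definition cauchy_filter_in :: "'a::ab_group_add topology \<Rightarrow> 'a filter \<Rightarrow> bool" where
  "cauchy_filter_in T F \<longleftrightarrow>
     (\<forall>U. openin T U \<and> 0 \<in> U \<longrightarrow> eventually (\<lambda>(x, y). x - y \<in> U) (F \<times>\<^sub>F F))"

definition complete_group_topology :: "'a::ab_group_add topology \<Rightarrow> bool" where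
  "complete_group_topology T \<longleftrightarrow>
     (\<forall>F. F \<noteq> bot \<and> cauchy_filter_in T F \<longrightarrow> (\<exists>l. limitin T (\<lambda>x. x) l F))"

section \<open>Locally C*-algebras\<close>

text \<open>Algebras are not assumed to be unital.\<close>

locale complex_star_algebra =
  vector_space scaleA
  for scaleA :: "complex \<Rightarrow> 'a::ring \<Rightarrow> 'a" +
  fixes star :: "'a \<Rightarrow> 'a"
  assumes scale_mult_left: "scaleA c a * b = scaleA c (a * b)"
    and scale_mult_right: "a * scaleA c b = scaleA c (a * b)"
    and star_add: "star (a + b) = star a + star b"
    and star_scale: "star (scaleA c a) = scaleA (cnj c) (star a)"
    and star_mult: "star (a * b) = star b * star a"
    and star_star: "star (star a) = a"

text \<open>Nonnegativity follows from the triangle inequality and homogeneity. Submultiplicativity is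
  not part of the definition.\<close>

definition cstar_seminorm ::
    "(complex \<Rightarrow> 'a::ring \<Rightarrow> 'a) \<Rightarrow> ('a \<Rightarrow> 'a) \<Rightarrow> ('a \<Rightarrow> real) \<Rightarrow> bool" where
  "cstar_seminorm scaleA star p \<longleftrightarrow>
     (\<forall>a b. p (a + b) \<le> p a + p b) \<and>
     (\<forall>c a. p (scaleA c a) = cmod c * p a) \<and>
     (\<forall>a. p (star a * a) = (p a)\<^sup>2)"

locale locally_cstar_algebra =
  complex_star_algebra scaleA star
  for scaleA :: "complex \<Rightarrow> 'a::ring \<Rightarrow> 'a" and star :: "'a \<Rightarrow> 'a" +
  fixes T :: "'a topology"
  assumes induced_by_cstar_seminorms:
      "\<exists>P. (\<forall>p\<in>P. cstar_seminorm scaleA star p) \<and> T = seminorm_topology P"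
    and Hausdorff: "Hausdorff_space T"
    and complete: "complete_group_topology T"

definition continuous_cstar_seminorms ::
    "(complex \<Rightarrow> 'a::ring \<Rightarrow> 'a) \<Rightarrow> ('a \<Rightarrow> 'a) \<Rightarrow> 'a topology \<Rightarrow> ('a \<Rightarrow> real) set" where
  "continuous_cstar_seminorms scaleA star T =
     {p. cstar_seminorm scaleA star p \<and> continuous_map T euclideanreal p}"

definition positive :: "('a::ring \<Rightarrow> 'a) \<Rightarrow> 'a \<Rightarrow> bool" where
  "positive star a \<longleftrightarrow> (\<exists>b. a = star b * b)"

section \<open>Hilbert modules\<close>

text \<open>The identities \<open>act (scaleH c f) a = scaleH c (act f a) = act f (scaleA c a)\<close> are not listed
  because they follow from the remaining axioms: the gramian is definite and linear in its second
  argument over both the complex numbers and the algebra.\<close>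

locale hilbert_module =
  locally_cstar_algebra scaleA star T +
  H: vector_space scaleH
  for scaleA :: "complex \<Rightarrow> 'a::ring \<Rightarrow> 'a" and star :: "'a \<Rightarrow> 'a" and T :: "'a topology"
    and scaleH :: "complex \<Rightarrow> 'h::ab_group_add \<Rightarrow> 'h" +
  fixes act :: "'h \<Rightarrow> 'a \<Rightarrow> 'h"
    and gram :: "'h \<Rightarrow> 'h \<Rightarrow> 'a"
  assumes act_add_left: "act (f + g) a = act f a + act g a"
    and act_add_right: "act f (a + b) = act f a + act f b"
    and act_act: "act (act f a) b = act f (a * b)"
    and gram_linear: "Vector_Spaces.linear scaleH scaleA (gram e)"
    and gram_star: "gram x y = star (gram y x)"
    and gram_positive: "positive star (gram x x)"
    and gram_eq_0_iff: "gram x x = 0 \<longleftrightarrow> x = 0"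
    and gram_act: "gram e (act f a + act g b) = gram e f * a + gram e g * b"
    and complete_module: "complete_group_topology
      (seminorm_topology
        ((\<lambda>p h. sqrt (p (gram h h))) ` continuous_cstar_seminorms scaleA star T))"

definition adjointable_operators ::
    "(complex \<Rightarrow> 'h::ab_group_add \<Rightarrow> 'h) \<Rightarrow> ('h \<Rightarrow> 'h \<Rightarrow> 'a) \<Rightarrow> ('h \<Rightarrow> 'h) set" where
  "adjointable_operators scaleH gram =
     {A. Vector_Spaces.linear scaleH scaleH A \<and>
         (\<exists>B. Vector_Spaces.linear scaleH scaleH B \<and> (\<forall>h k. gram (A h) k = gram h (B k)))}"

definition positive_semidefinite_kernel ::
    "('a::ring \<Rightarrow> 'a) \<Rightarrow> ('h \<Rightarrow> 'h \<Rightarrow> 'a) \<Rightarrow> 'x set \<Rightarrow> ('x \<Rightarrow> 'x \<Rightarrow> 'h \<Rightarrow> 'h) \<Rightarrow> bool" where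
  "positive_semidefinite_kernel star gram X k \<longleftrightarrow>
     (\<forall>(n::nat) (x :: nat \<Rightarrow> 'x) (h :: nat \<Rightarrow> 'h). (\<forall>i\<in>{1..n}. x i \<in> X) \<longrightarrow>
        positive star (\<Sum>i=1..n. \<Sum>j=1..n. gram (k (x i) (x j) (h j)) (h i)))"

end

theory Submission imports Defs "HOL-Real_Asymp.Real_Asymp" begin

text \<open>For \<open>u = (\<Sum>i. k(x, y\<^sub>i) h\<^sub>i)\<close> the left-hand side of the claim is \<open>p [u, u]\<close>. A positive semidefinite
kernel turns the finitely supported families of vectors into a semi-inner product module, and in
it \<open>[u, u]\<close> is the product of the family \<open>(y\<^sub>i, h\<^sub>i)\<close> with the family that has the single vector \<open>u\<close> at
\<open>x\<close>. If \<open>F\<close> is the double sum on the right-hand side, the Cauchy--Schwarz inequality gives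
\<open>p [u, u]\<^sup>2 \<le> D * p F * p [k(x, x) u, u]\<close>. The operator \<open>k(x, x)\<close> is bounded with respect to \<open>p\<close>,
so the last factor is at most \<open>C * p [u, u]\<close>, and \<open>p [u, u]\<close> cancels. Two facts carry this
argument: a Cauchy--Schwarz inequality for \<open>p\<close> and the boundedness of adjointable operators. As the
claim asks for some constant only, all estimates are made up to constants, in terms of the
seminorms, without representations or a continuous functional calculus.

Cauchy--Schwarz (\<open>cauchy_schwarz_bound\<close>). The parallelogram law, polarization and scaling reduce it
to \<open>p (a\<^sup>*a) \<le> K * p (a\<^sup>*a + b\<^sup>*b)\<close> (\<open>positive_summand_bound\<close>), which says that positive elements
cannot cancel each other. With \<open>s = a\<^sup>*a + b\<^sup>*b\<close> and \<open>z = a b\<^sup>*\<close> one has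
\<open>z z\<^sup>* + z\<^sup>* z + (a a\<^sup>*)\<^sup>2 + (b b\<^sup>*)\<^sup>2 = a s a\<^sup>* + b s b\<^sup>*\<close>, and \<open>z z\<^sup>* + z\<^sup>* z\<close> is a sum of two squares
of self-adjoint elements. So it is enough that the squares of four self-adjoint elements do not
cancel each other (\<open>four_squares\<close>). That follows from the contraction property of \<open>1 - h\<^sup>2\<close>
(\<open>one_minus_square_contraction\<close>), and the source of this property is the inequality
\<open>p (a)\<^sup>2 \<le> p (a\<^sup>*a + b\<^sup>*b)\<close> for \<open>a\<^sup>*b = b\<^sup>*a\<close> (\<open>two_squares\<close>), where \<open>a\<^sup>*a + b\<^sup>*b\<close> is the square
\<open>z\<^sup>*z\<close> of the modulus of both \<open>z = a + ib\<close> and \<open>z = a - ib\<close>.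

Boundedness (\<open>adjointable_bounded\<close>). The uniform boundedness argument sums a series of vectors and
needs the terms to be small for all continuous \<open>C\<^sup>*\<close>-seminorms at once, while unboundedness is known
for the single seminorm \<open>p\<close>. Multiplying a vector \<open>u\<close> from the right by \<open>(1 + [u, u]\<^sup>2)\<^bsup>-1\<^esup>\<close> brings it
into the unit ball of every \<open>C\<^sup>*\<close>-seminorm and loses at most a constant factor with
respect to \<open>p\<close> if \<open>p [u, u] \<le> 1\<close> (\<open>ex_simultaneously_bounded\<close>). These
inverses exist by completeness of the algebra.\<close>

section \<open>Seminorms with the \<open>C\<^sup>*\<close>-identity\<close>

context complex_star_algebra
begin

abbreviation rscale :: "real \<Rightarrow> 'a \<Rightarrow> 'a" (infixr "*r" 75)
  where "c *r a \<equiv> scaleA (complex_of_real c) a"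

lemma star_zero [simp]: "star 0 = 0"
  using star_add[of 0 0] by simp

lemma star_minus: "star (- a) = - star a"
  using star_add[of a "- a"] by (simp add: eq_neg_iff_add_eq_0 add.commute)

lemma star_diff: "star (a - b) = star a - star b"
  using star_add[of a "- b"] by (simp add: star_minus)

lemma star_sum: "star (\<Sum>i\<in>I. f i) = (\<Sum>i\<in>I. star (f i))"
  by (induction I rule: infinite_finite_induct) (simp_all add: star_add)

lemmas star_simps = star_add star_diff star_minus star_mult star_star star_scale
lemmas scale_simps = scale_mult_left scale_mult_right

end

text \<open>Inequalities between quadratic expressions are turned into product inequalities by rescaling both
arguments. The optimal \<open>s\<close> is \<open>sqrt (B / A)\<close>; if \<open>A\<close> or \<open>B\<close> vanishes, \<open>s\<close> tends to infinity or to \<open>0\<close>.\<close>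

lemma optimize_scaling:
  fixes x c A B :: real
  assumes "A \<ge> 0" "B \<ge> 0" "x \<ge> 0" "c \<ge> 0"
    and le: "\<And>s. s > 0 \<Longrightarrow> x \<le> c * (s * A + B / s)"
  shows "x\<^sup>2 \<le> 4 * c\<^sup>2 * A * B"
proof (cases "A = 0 \<or> B = 0")
  case True
  have "x \<le> 0 + e" if "e > 0" for e
  proof -
    define d where "d = (1 + c) * (1 + A + B)"
    have d: "d > 0" using assms unfolding d_def by (intro mult_pos_pos) auto
    have "c * (A + B) \<le> (1 + c) * (1 + A + B)"
      using assms by (intro mult_mono) auto
    hence cd: "c * (A + B) \<le> d" by (simp add: d_def)
    from True show ?thesis
    proof
      assume [simp]: "A = 0"
      have "x \<le> c * B * (e / d)" using le[of "d / e"] d that by (simp add: field_simps)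
      also have "\<dots> \<le> d * (e / d)" using cd d that by (intro mult_right_mono) auto
      finally show ?thesis using d by simp
    next
      assume [simp]: "B = 0"
      have "x \<le> c * A * (e / d)" using le[of "e / d"] d that by (simp add: field_simps)
      also have "\<dots> \<le> d * (e / d)" using cd d that by (intro mult_right_mono) auto
      finally show ?thesis using d by simp
    qed
  qed
  hence "x \<le> 0" using field_le_epsilon by blast
  with \<open>x \<ge> 0\<close> have "x = 0" by simp
  thus ?thesis using True by auto
next
  case False
  hence A: "A > 0" and B: "B > 0" using assms by auto
  have e1: "sqrt (B / A) * A = sqrt A * sqrt B"
    using A B by (simp add: real_sqrt_divide field_simps)
  have e2: "B / sqrt (B / A) = sqrt A * sqrt B"
    using A B by (simp add: real_sqrt_divide field_simps)
  have "x \<le> c * (sqrt A * sqrt B + sqrt A * sqrt B)"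
    using le[of "sqrt (B / A)"] A B unfolding e1 e2 by simp
  hence "x\<^sup>2 \<le> (c * (sqrt A * sqrt B + sqrt A * sqrt B))\<^sup>2"
    using assms by (intro power_mono) auto
  also have "\<dots> = 4 * c\<^sup>2 * A * B" using A B by (simp add: power_mult_distrib)
  finally show ?thesis .
qed

locale cstar_seminormed_algebra = complex_star_algebra scaleA star
  for scaleA :: "complex \<Rightarrow> 'a::ring \<Rightarrow> 'a" and star :: "'a \<Rightarrow> 'a" +
  fixes p :: "'a \<Rightarrow> real"
  assumes cstar_seminorm: "cstar_seminorm scaleA star p"
begin

lemma triangle: "p (a + b) \<le> p a + p b"
  and p_scale: "p (scaleA c a) = cmod c * p a"
  and cstar_identity: "p (star a * a) = (p a)\<^sup>2"
  using cstar_seminorm by (simp_all add: cstar_seminorm_def)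

lemma p_zero [simp]: "p 0 = 0"
  using p_scale[of 0 0] by simp

lemma p_minus [simp]: "p (- a) = p a"
  using p_scale[of "-1" a] by simp

lemma p_nonneg [simp]: "p a \<ge> 0"
  using triangle[of a "- a"] by simp

lemma triangle_diff: "p (a - b) \<le> p a + p b"
  using triangle[of a "- b"] by simp

lemma p_double: "p (a + a) = 2 * p a"
  using p_scale[of 2 a] scale_left_distrib[of 1 1 a] by simp

lemma p_sum: "p (\<Sum>i\<in>I. f i) \<le> (\<Sum>i\<in>I. p (f i))"
  by (induction I rule: infinite_finite_induct) (auto intro: order_trans[OF triangle])

text \<open>With \<open>z = a + ib\<close> and \<open>w = a - ib\<close> the hypothesis removes the cross terms from \<open>z\<^sup>*z\<close> and \<open>w\<^sup>*w\<close>, so both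
equal \<open>a\<^sup>*a + b\<^sup>*b\<close>, and \<open>a\<close> is the mean of \<open>z\<close> and \<open>w\<close>.\<close>

lemma two_squares:
  assumes "star a * b = star b * a"
  shows "(p a)\<^sup>2 \<le> p (star a * a + star b * b)"
proof -
  let ?z = "a + scaleA \<i> b" and ?w = "a - scaleA \<i> b"
  have "star ?z * ?z = star a * a + star b * b" "star ?w * ?w = star a * a + star b * b"
    using assms by (simp_all add: star_simps scale_simps algebra_simps)
  hence "p ?z = sqrt (p (star a * a + star b * b))" "p ?w = sqrt (p (star a * a + star b * b))"
    using cstar_identity[of ?z] cstar_identity[of ?w] by (simp_all add: real_sqrt_unique)
  moreover have "2 * p a \<le> p ?z + p ?w"
    using triangle[of ?z ?w] p_double[of a] by (simp add: algebra_simps)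
  ultimately have "p a \<le> sqrt (p (star a * a + star b * b))" by simp
  thus ?thesis using real_le_rsqrt real_sqrt_le_iff sqrt_le_D by (metis p_nonneg power_mono real_sqrt_pow2)
qed

text \<open>A weak form of submultiplicativity that follows from polarization and scaling alone.\<close>

lemma polarization_bound: "p (star a * b) \<le> 4 * p a * p b"
proof -
  have real_part: "p (star a * b + star b * a) \<le> (p a + p b)\<^sup>2" for a b
  proof -
    have "star (a + b) * (a + b) - star (a - b) * (a - b)
        = (star a * b + star b * a) + (star a * b + star b * a)"
      by (simp add: star_simps algebra_simps)
    hence "2 * p (star a * b + star b * a) \<le> (p (a + b))\<^sup>2 + (p (a - b))\<^sup>2"
      using triangle_diff[of "star (a + b) * (a + b)" "star (a - b) * (a - b)"]
      by (simp only: p_double cstar_identity)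
    also have "\<dots> \<le> (p a + p b)\<^sup>2 + (p a + p b)\<^sup>2"
      by (intro add_mono power_mono triangle triangle_diff) auto
    finally show ?thesis by simp
  qed
  have crude: "p (star a * b) \<le> (p a + p b)\<^sup>2" for a b
  proof -
    let ?h = "star a * b + star b * a"
    let ?k = "star a * scaleA \<i> b + star (scaleA \<i> b) * a"
    have "star a * b + star a * b = ?h - scaleA \<i> ?k"
      by (simp add: star_simps scale_simps algebra_simps)
    hence "2 * p (star a * b) = p (?h - scaleA \<i> ?k)"
      using p_double[of "star a * b"] by (simp only:)
    also have "\<dots> \<le> p ?h + p ?k"
      using triangle_diff[of ?h "scaleA \<i> ?k"] p_scale[of \<i> ?k] by (simp only: norm_ii mult_1)
    also have "\<dots> \<le> (p a + p b)\<^sup>2 + (p a + p b)\<^sup>2"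
      using real_part[of a b] real_part[of a "scaleA \<i> b"] by (simp add: p_scale)
    finally show ?thesis by simp
  qed
  have "(p (star a * b))\<^sup>2 \<le> 4 * 2\<^sup>2 * (p a)\<^sup>2 * (p b)\<^sup>2"
  proof (rule optimize_scaling)
    fix s :: real assume s: "s > 0"
    define r where "r = sqrt s"
    have r: "r > 0" "r\<^sup>2 = s" using s by (simp_all add: r_def)
    have "star (r *r a) * ((1/r) *r b) = star a * b"
      using r by (simp add: star_simps scale_simps flip: of_real_mult)
    hence "p (star a * b) \<le> (p (r *r a) + p ((1/r) *r b))\<^sup>2"
      using crude[of "r *r a" "(1/r) *r b"] by simp
    also have "\<dots> = (r * p a + p b / r)\<^sup>2" using r by (simp add: p_scale norm_divide)
    also have "\<dots> \<le> 2 * ((r * p a)\<^sup>2 + (p b / r)\<^sup>2)"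
      using sum_squares_bound[of "r * p a" "p b / r"] by (simp add: power2_sum)
    also have "\<dots> = 2 * (s * (p a)\<^sup>2 + (p b)\<^sup>2 / s)"
      by (simp add: power_mult_distrib power_divide r)
    finally show "p (star a * b) \<le> 2 * (s * (p a)\<^sup>2 + (p b)\<^sup>2 / s)" .
  qed auto
  also have "\<dots> = (4 * p a * p b)\<^sup>2" by (simp add: power_mult_distrib)
  finally show ?thesis by (rule power2_le_imp_le) auto
qed

text \<open>Regrouping \<open>(a\<^sup>*a)\<^sup>2 = a\<^sup>* ((a a\<^sup>*) a)\<close> brings in \<open>p (a a\<^sup>*) = p (a\<^sup>*)\<^sup>2\<close>.\<close>

lemma p_le_p_star: "p a \<le> 4 * p (star a)"
proof (cases "p a = 0")
  case False
  hence pos: "p a > 0" using p_nonneg[of a] by linarith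
  have "(p a)\<^sup>2 * (p a)\<^sup>2 = p (star (star a * a) * (star a * a))"
    unfolding cstar_identity by (simp add: power2_eq_square)
  also have "star (star a * a) * (star a * a) = star a * (star (a * star a) * a)"
    by (simp add: star_simps mult.assoc)
  also have "p \<dots> \<le> 4 * p a * (4 * p (a * star a) * p a)"
    using polarization_bound[of "a * star a" a]
    by (intro order_trans[OF polarization_bound] mult_left_mono) auto
  also have "p (a * star a) = (p (star a))\<^sup>2" using cstar_identity[of "star a"] by (simp add: star_star)
  finally have "(p a)\<^sup>2 * (p a)\<^sup>2 \<le> (p a)\<^sup>2 * (4 * p (star a))\<^sup>2"
    by (simp add: power2_eq_square mult_ac)
  hence "(p a)\<^sup>2 \<le> (4 * p (star a))\<^sup>2" using pos by (simp only: mult_le_cancel_left_pos zero_less_power)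
  thus ?thesis by (rule power2_le_imp_le) simp
qed simp

lemma mult_bound: "p (a * b) \<le> 16 * p a * p b"
proof -
  have "p (a * b) \<le> 4 * p (star a) * p b" using polarization_bound[of "star a" b] by (simp add: star_star)
  also have "\<dots> \<le> 4 * (4 * p a) * p b"
    using p_le_p_star[of "star a"] by (intro mult_right_mono mult_left_mono) (auto simp: star_star)
  finally show ?thesis by simp
qed

lemma selfadjoint_mult_bound: "star h = h \<Longrightarrow> p (h * b) \<le> 4 * p h * p b"
  using polarization_bound[of h b] by simp

lemma selfadjoint_square: "star h = h \<Longrightarrow> p (h * h) = (p h)\<^sup>2"
  using cstar_identity[of h] by simp

end

section \<open>Subtraction of the square of a self-adjoint element\<close>

text \<open>The iteration \<open>y \<mapsto> (t + y\<^sup>2) / 2\<close> from \<open>0\<close> converges to \<open>1 - sqrt (1 - t)\<close>. Its defects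
\<open>(1 - y)\<^sup>2 - (1 - t)\<close> have nonnegative coefficients, so the sum of the moduli of their coefficients is
the value at \<open>1\<close>, and this tends to \<open>0\<close>. Hence the defects become small on every element whose powers
are bounded, without any estimate for the coefficients of a binomial series.\<close>

fun sqrt_iterate :: "nat \<Rightarrow> real poly" where
  "sqrt_iterate 0 = 0"
| "sqrt_iterate (Suc n) = smult (1/2) ([:0, 1:] + sqrt_iterate n ^ 2)"

definition sqrt_defect :: "nat \<Rightarrow> real poly" where
  "sqrt_defect n = (1 - sqrt_iterate n)\<^sup>2 - [:1, -1:]"

definition nonneg_coeffs :: "real poly \<Rightarrow> bool" where
  "nonneg_coeffs q \<longleftrightarrow> (\<forall>i. coeff q i \<ge> 0)"

lemma nonneg_coeffs_add: "nonneg_coeffs q \<Longrightarrow> nonneg_coeffs r \<Longrightarrow> nonneg_coeffs (q + r)"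
  by (simp add: nonneg_coeffs_def)

lemma nonneg_coeffs_smult: "c \<ge> 0 \<Longrightarrow> nonneg_coeffs q \<Longrightarrow> nonneg_coeffs (smult c q)"
  by (simp add: nonneg_coeffs_def)

lemma nonneg_coeffs_mult: "nonneg_coeffs q \<Longrightarrow> nonneg_coeffs r \<Longrightarrow> nonneg_coeffs (q * r)"
  by (simp add: nonneg_coeffs_def coeff_mult sum_nonneg)

lemma nonneg_coeffs_pCons: "nonneg_coeffs (pCons a q) \<longleftrightarrow> a \<ge> 0 \<and> nonneg_coeffs q"
  unfolding nonneg_coeffs_def
  by (metis coeff_pCons_0 coeff_pCons_Suc not0_implies_Suc)

lemma nonneg_coeffs_zero [simp]: "nonneg_coeffs 0"
  by (simp add: nonneg_coeffs_def)

lemma nonneg_coeffs_sqrt_iterate: "nonneg_coeffs (sqrt_iterate n)"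
  by (induction n)
     (auto simp: power2_eq_square nonneg_coeffs_pCons simp del: mult_smult_left
        intro!: nonneg_coeffs_smult nonneg_coeffs_add nonneg_coeffs_mult)

lemma sqrt_defect_step: "sqrt_defect n = smult 2 (sqrt_iterate (Suc n) - sqrt_iterate n)"
  unfolding sqrt_defect_def
  by (rule poly_eq_poly_eq_iff[THEN iffD1], rule ext) (simp add: power2_eq_square algebra_simps)

lemma sqrt_defect_Suc:
  "sqrt_defect (Suc n) = smult (1/2) (sqrt_defect n * (sqrt_iterate (Suc n) + sqrt_iterate n))"
  unfolding sqrt_defect_step
  by (rule poly_eq_poly_eq_iff[THEN iffD1], rule ext) (simp add: power2_eq_square algebra_simps)

lemma nonneg_coeffs_sqrt_defect: "nonneg_coeffs (sqrt_defect n)"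
proof (induction n)
  case 0
  show ?case by (simp add: sqrt_defect_step nonneg_coeffs_pCons)
next
  case (Suc n)
  then show ?case unfolding sqrt_defect_Suc
    by (intro nonneg_coeffs_smult nonneg_coeffs_mult nonneg_coeffs_add nonneg_coeffs_sqrt_iterate) auto
qed

text \<open>The distance \<open>d\<close> from \<open>1\<close> satisfies the recursion \<open>d \<mapsto> d - d\<^sup>2 / 2\<close>, which is increasing on \<open>[0, 1]\<close>.\<close>

lemma sqrt_iterate_at_1:
  "poly (sqrt_iterate n) 1 \<le> 1 \<and> 1 - poly (sqrt_iterate n) 1 \<le> 2 / (real n + 2)"
proof (induction n)
  case (Suc n)
  define d where "d = 1 - poly (sqrt_iterate n) 1"
  define m where "m = real n + 2"
  have d: "d \<ge> 0" "d \<le> 2 / m" and m: "m \<ge> 2" using Suc by (simp_all add: d_def m_def)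
  have eq: "1 - poly (sqrt_iterate (Suc n)) 1 = d - d\<^sup>2 / 2"
    by (simp add: d_def power2_eq_square field_simps)
  have "2 / m \<le> 1" using m by simp
  hence d1: "d \<le> 1" using d by linarith
  have "d - d\<^sup>2 / 2 \<le> 2 / m - (2 / m)\<^sup>2 / 2"
  proof -
    have "(w - w\<^sup>2 / 2) - (d - d\<^sup>2 / 2) = (w - d) * (1 - (w + d) / 2)" for w
      by (simp add: power2_eq_square field_simps)
    hence "(2 / m - (2 / m)\<^sup>2 / 2) - (d - d\<^sup>2 / 2) = (2 / m - d) * (1 - (2 / m + d) / 2)" .
    also have "\<dots> \<ge> 0" using d d1 \<open>2 / m \<le> 1\<close> by (intro mult_nonneg_nonneg) auto
    finally show ?thesis by linarith
  qed
  also have "\<dots> \<le> 2 / (m + 1)" using m by (simp add: field_simps power2_eq_square)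
  finally have "d - d\<^sup>2 / 2 \<le> 2 / (real (Suc n) + 2)" by (simp add: m_def add_ac)
  moreover have "d - d\<^sup>2 / 2 \<ge> 0"
    using mult_right_mono[of d 2 d] d d1 by (simp add: power2_eq_square mult.commute)
  ultimately show ?case using eq by linarith
qed simp

lemma sqrt_defect_at_1: "(\<lambda>n. poly (sqrt_defect n) 1) \<longlonglongrightarrow> 0"
proof (rule tendsto_sandwich[OF _ _ tendsto_const])
  show "\<forall>\<^sub>F n in sequentially. 0 \<le> poly (sqrt_defect n) 1"
    by (simp add: sqrt_defect_def)
  show "\<forall>\<^sub>F n in sequentially. poly (sqrt_defect n) 1 \<le> (2 / (real n + 2))\<^sup>2"
    using sqrt_iterate_at_1
    by (intro always_eventually allI) (auto simp: sqrt_defect_def intro!: power_mono)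
  have "(\<lambda>n. 2 / (real n + 2)) \<longlonglongrightarrow> 0" by real_asymp
  thus "(\<lambda>n. (2 / (real n + 2))\<^sup>2) \<longlonglongrightarrow> 0"
    by (metis tendsto_power power_zero_numeral)
qed

context complex_star_algebra
begin

text \<open>The algebra may have no unit, so \<open>q(z)\<close> is defined as an operator of left multiplication.\<close>

definition poly_act :: "'a \<Rightarrow> real poly \<Rightarrow> 'a \<Rightarrow> 'a" where
  "poly_act z q e = (\<Sum>i\<le>degree q. coeff q i *r (((*) z ^^ i) e))"

lemma poly_act_eq_sum:
  assumes "degree q \<le> n"
  shows "poly_act z q e = (\<Sum>i\<le>n. coeff q i *r (((*) z ^^ i) e))"
  unfolding poly_act_def using assms
  by (intro sum.mono_neutral_left) (auto simp: coeff_eq_0)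

lemma mult_rscale: "z * (c *r a) = c *r (z * a)" "(c *r a) * z = c *r (a * z)"
  by (simp_all add: scale_simps)

lemma poly_act_pCons: "poly_act z (pCons c q) e = c *r e + z * poly_act z q e"
proof -
  have "poly_act z (pCons c q) e = (\<Sum>i\<le>Suc (degree q). coeff (pCons c q) i *r (((*) z ^^ i) e))"
    by (rule poly_act_eq_sum) (simp add: degree_pCons_le)
  also have "\<dots> = c *r e + (\<Sum>i\<le>degree q. coeff q i *r (z * (((*) z ^^ i) e)))"
    by (subst sum.atMost_Suc_shift) simp
  also have "(\<Sum>i\<le>degree q. coeff q i *r (z * (((*) z ^^ i) e))) = z * poly_act z q e"
    by (simp add: poly_act_def sum_distrib_left mult_rscale)
  finally show ?thesis .
qed

lemma poly_act_0 [simp]: "poly_act z 0 e = 0"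
  by (simp add: poly_act_def)

lemma poly_act_1 [simp]: "poly_act z 1 e = e"
  by (simp add: poly_act_def)

lemma poly_act_add: "poly_act z (q + r) e = poly_act z q e + poly_act z r e"
  by (induction q r rule: poly_induct2) (simp_all add: poly_act_pCons algebra_simps)

lemma poly_act_smult: "poly_act z (smult c q) e = c *r poly_act z q e"
  by (induction q) (simp_all add: poly_act_pCons algebra_simps mult_rscale)

lemma poly_act_mult: "poly_act z (q * r) e = poly_act z q (poly_act z r e)"
  by (induction q) (simp_all add: poly_act_pCons poly_act_add poly_act_smult)

lemma poly_act_X: "poly_act z [:0, c:] e = c *r (z * e)"
  by (simp add: poly_act_pCons mult_rscale)

lemma star_poly_act:
  assumes "star z = z"
  shows "star (poly_act z q e) * b = star e * poly_act z q b"
proof (induction q arbitrary: b)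
  case (pCons c q)
  have "star (poly_act z (pCons c q) e) * b = c *r (star e * b) + star (poly_act z q e) * (z * b)"
    by (simp add: poly_act_pCons star_simps scale_simps algebra_simps assms)
  also have "star (poly_act z q e) * (z * b) = star e * poly_act z q (z * b)" by (rule pCons.IH)
  also have "poly_act z q (z * b) = poly_act z (q * [:0, 1:]) b"
    unfolding poly_act_mult by (simp add: poly_act_X)
  also have "\<dots> = z * poly_act z q b"
    using poly_act_pCons[of z 0 q b] by simp
  finally show ?case by (simp add: poly_act_pCons scale_simps algebra_simps)
qed simp

end

context cstar_seminormed_algebra
begin

lemma nonneg_poly_act_bound:
  assumes "nonneg_coeffs q" and pow: "\<And>i. p (((*) z ^^ i) e) \<le> C"
  shows "p (poly_act z q e) \<le> poly q 1 * C"
proof -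
  have "p (poly_act z q e) \<le> (\<Sum>i\<le>degree q. coeff q i * p (((*) z ^^ i) e))"
    using assms(1) unfolding poly_act_def
    by (intro order_trans[OF p_sum] sum_mono) (simp add: p_scale nonneg_coeffs_def)
  also have "\<dots> \<le> (\<Sum>i\<le>degree q. coeff q i * C)"
    using assms by (intro sum_mono mult_left_mono) (auto simp: nonneg_coeffs_def)
  also have "\<dots> = poly q 1 * C" by (simp add: poly_altdef sum_distrib_right)
  finally show ?thesis .
qed

text \<open>Left multiplication by a self-adjoint \<open>b\<close> costs a factor \<open>4\<close>. The square of \<open>h\<^sup>2 / 2\<close> is \<open>h\<^sup>4 / 4\<close>, so the
factor \<open>1/4\<close> compensates this loss for every second power.\<close>

lemma half_square_powers_bound:
  assumes h: "star h = h" "p h \<le> 1"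
  shows "p (((*) ((1/2) *r (h * h)) ^^ i) e) \<le> 2 * p e"
proof -
  let ?z = "(1/2) *r (h * h)"
  have hh: "star (h * h) = h * h" "p (h * h) \<le> 1"
    using h by (simp_all add: star_simps selfadjoint_square power_le_one)
  have hhhh: "star (h * h * (h * h)) = h * h * (h * h)" "p (h * h * (h * h)) \<le> 1"
    using hh selfadjoint_square[of "h * h"] by (simp_all add: star_mult power_le_one)
  have one: "p (?z * b) \<le> 2 * p b" for b
  proof -
    have "p (?z * b) = p (h * h * b) / 2"
      by (simp add: scale_simps p_scale norm_divide)
    also have "\<dots> \<le> (4 * p (h * h) * p b) / 2"
      using selfadjoint_mult_bound[OF hh(1)] by (intro divide_right_mono) auto
    also have "\<dots> \<le> (4 * 1 * p b) / 2"
      using hh by (intro divide_right_mono mult_right_mono mult_left_mono) auto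
    finally show ?thesis by simp
  qed
  have two: "p (?z * (?z * b)) \<le> p b" for b
  proof -
    have "?z * (?z * b) = (1/4) *r (h * h * (h * h) * b)"
      by (simp add: scale_simps mult.assoc)
    hence "p (?z * (?z * b)) = p (h * h * (h * h) * b) / 4"
      by (simp add: p_scale norm_divide)
    also have "\<dots> \<le> (4 * p (h * h * (h * h)) * p b) / 4"
      using selfadjoint_mult_bound[OF hhhh(1)] by (intro divide_right_mono) auto
    also have "\<dots> \<le> (4 * 1 * p b) / 4"
      using hhhh by (intro divide_right_mono mult_right_mono mult_left_mono) auto
    finally show ?thesis by simp
  qed
  show ?thesis
  proof (induction i rule: induct_nat_012)
    case (ge2 n)
    then show ?case using two[of "((*) ?z ^^ n) e"] by simp
  qed (use one in auto)
qed

text \<open>As functions of a real variable \<open>1 - h\<^sup>2\<close> and \<open>b = h sqrt (2 - h\<^sup>2)\<close> satisfy \<open>(1 - h\<^sup>2)\<^sup>2 + b\<^sup>2 = 1\<close>, and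
\<open>two_squares\<close> would give the claim at once. The square root is replaced by its polynomial
approximations in \<open>z = h\<^sup>2 / 2\<close>, at the price of an error that tends to \<open>0\<close>.\<close>

lemma one_minus_square_contraction:
  assumes h: "star h = h" "p h \<le> 1"
  shows "p (e - h * (h * e)) \<le> p e"
proof -
  define z where "z = (1/2) *r (h * h)"
  have z: "star z = z" using h by (simp add: z_def star_simps)
  have zz: "h * (h * b) = 2 *r (z * b)" for b
    by (simp add: z_def scale_simps mult.assoc)
  define a where "a = poly_act z [:1, -2:] e"
  have a: "a = e - h * (h * e)" by (simp add: a_def poly_act_pCons zz scale_simps)
  have bound: "(p a)\<^sup>2 \<le> (p e)\<^sup>2 + 32 * (p e)\<^sup>2 * poly (sqrt_defect n) 1" for n
  proof -
    define Y where "Y = 1 - sqrt_iterate n"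
    define b where "b = sqrt 2 *r (h * poly_act z Y e)"
    have aa: "star a * a = star e * poly_act z ([:1, -2:] * [:1, -2:]) e"
      by (simp add: a_def star_poly_act[OF z] poly_act_mult del: mult_pCons_left mult_pCons_right)
    have "star b * b = 2 *r (star (poly_act z Y e) * (h * (h * poly_act z Y e)))"
      by (simp add: b_def star_simps scale_simps h mult.assoc flip: of_real_mult)
    also have "\<dots> = star (poly_act z Y e) * poly_act z ([:0, 4:] * Y) e"
      unfolding zz poly_act_mult poly_act_X by (simp add: scale_simps)
    also have "\<dots> = star e * poly_act z (Y * ([:0, 4:] * Y)) e"
      unfolding star_poly_act[OF z] poly_act_mult[symmetric] ..
    finally have bb: "star b * b = star e * poly_act z (Y * ([:0, 4:] * Y)) e" .
    (* With t = h^2 / 2 the identity is (1 - 2t)^2 + 4t Y^2 = 1 + 4t (Y^2 - (1 - t)). *)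
    have "[:1, -2:] * [:1, -2:] + Y * ([:0, 4:] * Y) = 1 + [:0, 4:] * sqrt_defect n"
      unfolding Y_def sqrt_defect_def
      by (rule poly_eq_poly_eq_iff[THEN iffD1], rule ext) (simp add: power2_eq_square algebra_simps)
    hence sum: "star a * a + star b * b = star e * e + star e * poly_act z ([:0, 4:] * sqrt_defect n) e"
      unfolding aa bb distrib_left[symmetric] poly_act_add[symmetric] by (simp only: poly_act_add poly_act_1)
    have comm: "star a * b = star b * a"
    proof -
      have hz: "h * (z * c) = z * (h * c)" for c
        by (simp add: z_def scale_simps mult.assoc)
      have hq: "h * poly_act z q c = poly_act z q (h * c)" for q c
        by (induction q) (simp_all add: poly_act_pCons distrib_left mult_rscale hz)
      have "star a * b = sqrt 2 *r (star e * poly_act z ([:1, -2:] * Y) (h * e))"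
        by (simp add: a_def b_def mult_rscale star_poly_act[OF z] hq poly_act_mult
          del: mult_pCons_left mult_pCons_right)
      moreover have "star b * a = sqrt 2 *r (star e * poly_act z (Y * [:1, -2:]) (h * e))"
        by (simp add: b_def a_def mult_rscale star_simps scale_simps h mult.assoc star_poly_act[OF z] hq
          poly_act_mult del: mult_pCons_left mult_pCons_right)
      ultimately show ?thesis by (simp only: mult.commute)
    qed
    have "p (poly_act z ([:0, 4:] * sqrt_defect n) e) \<le> poly ([:0, 4:] * sqrt_defect n) 1 * (2 * p e)"
      unfolding z_def
      by (intro nonneg_poly_act_bound half_square_powers_bound h nonneg_coeffs_mult nonneg_coeffs_sqrt_defect)
        (simp add: nonneg_coeffs_pCons)
    hence "p (star e * poly_act z ([:0, 4:] * sqrt_defect n) e)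
        \<le> 4 * p e * (poly ([:0, 4:] * sqrt_defect n) 1 * (2 * p e))"
      by (intro order_trans[OF polarization_bound] mult_left_mono) auto
    hence "p (star a * a + star b * b) \<le> (p e)\<^sup>2 + 32 * (p e)\<^sup>2 * poly (sqrt_defect n) 1"
      unfolding sum using triangle[of "star e * e" "star e * poly_act z ([:0, 4:] * sqrt_defect n) e"]
      by (simp add: cstar_identity power2_eq_square mult_ac)
    with two_squares[OF comm] show ?thesis by linarith
  qed
  have "(\<lambda>n. (p e)\<^sup>2 + 32 * (p e)\<^sup>2 * poly (sqrt_defect n) 1) \<longlonglongrightarrow> (p e)\<^sup>2 + 32 * (p e)\<^sup>2 * 0"
    by (intro tendsto_intros sqrt_defect_at_1)
  hence "(p a)\<^sup>2 \<le> (p e)\<^sup>2" using bound by (intro LIMSEQ_le_const) auto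
  hence "p a \<le> p e" by (rule power2_le_imp_le) simp
  thus ?thesis by (simp add: a)
qed

section \<open>Sums of positive elements\<close>

text \<open>Let \<open>s\<close> be the sum of the squares. Contractivity of the three \<open>1 - h\<^sub>i\<^sup>2\<close> with \<open>i \<ge> 2\<close> bounds
\<open>3 - (s - h\<^sub>1\<^sup>2)\<close> by \<open>3\<close>, so a small \<open>s\<close> makes \<open>3 + h\<^sub>1\<^sup>2\<close> an operator of norm close to \<open>3\<close>. Applied to
\<open>h\<^sub>1\<close> this contradicts \<open>(3 + t)\<^sup>2 = 12 t + (3 - t)\<^sup>2\<close> with \<open>t = h\<^sub>1\<^sup>2\<close>, since \<open>sqrt 12 > 3\<close>. For five
squares the same argument would only give \<open>sqrt 16 = 4\<close> and no contradiction.\<close>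

lemma four_squares_normalized:
  assumes sa: "star h1 = h1" "star h2 = h2" "star h3 = h3" "star h4 = h4"
    and le: "p h1 = 1" "p h2 \<le> 1" "p h3 \<le> 1" "p h4 \<le> 1"
  shows "1 \<le> 10 * p (h1 * h1 + h2 * h2 + h3 * h3 + h4 * h4)"
proof -
  define s where "s = h1 * h1 + h2 * h2 + h3 * h3 + h4 * h4"
  have s: "star s = s" using sa by (simp add: s_def star_simps)
  define c where "c = h1 * h1 * h1"
  define w g f where "w = 3 *r h1 + c" and "g = 3 *r h1 - c" and "f = sqrt 12 *r (h1 * h1)"
  have c: "star c = c" "h1 * c = c * h1" using sa by (simp_all add: c_def star_simps mult.assoc)
  have "w = (h1 - h2 * (h2 * h1)) + (h1 - h3 * (h3 * h1)) + (h1 - h4 * (h4 * h1)) + s * h1"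
    using scale_left_distrib[of 1 1 h1] scale_left_distrib[of 2 1 h1]
    by (simp add: w_def c_def s_def algebra_simps)
  also have "p \<dots> \<le> p h1 + p h1 + p h1 + 4 * p s * p h1"
    by (intro order_trans[OF triangle] add_mono one_minus_square_contraction selfadjoint_mult_bound s sa le)
  finally have upper: "p w \<le> 3 + 4 * p s" using le by simp
  have "star f * f = 12 *r (h1 * h1 * (h1 * h1))"
    by (simp add: f_def star_simps scale_simps sa flip: of_real_mult)
  moreover have "star w * w - star g * g = 12 *r (h1 * c)"
    by (simp add: w_def g_def star_simps scale_simps c sa algebra_simps flip: scale_left_distrib)
  ultimately have eq: "star f * f + star g * g = star w * w"
    by (simp add: c_def mult.assoc algebra_simps)
  have "star f * g = star g * f"
    by (simp add: f_def g_def star_simps scale_simps sa c) (simp add: c_def algebra_simps scale_simps)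
  from two_squares[OF this] have "(p f)\<^sup>2 \<le> (p w)\<^sup>2"
    unfolding eq cstar_identity .
  moreover have "(p f)\<^sup>2 = 12"
    using le sa by (simp add: f_def p_scale selfadjoint_square power_mult_distrib)
  ultimately have "12 \<le> (3 + 4 * p s)\<^sup>2"
    using power_mono[OF upper p_nonneg, of 2] by linarith
  hence "\<not> p s < 1 / 10"
    using power_strict_mono[of "3 + 4 * p s" "3.4" 2] by (auto simp: power2_eq_square)
  thus ?thesis unfolding s_def by simp
qed

lemma four_squares_largest:
  assumes sa: "star h1 = h1" "star h2 = h2" "star h3 = h3" "star h4 = h4"
    and le: "p h2 \<le> p h1" "p h3 \<le> p h1" "p h4 \<le> p h1"
  shows "(p h1)\<^sup>2 \<le> 10 * p (h1 * h1 + h2 * h2 + h3 * h3 + h4 * h4)"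
proof (cases "p h1 = 0")
  case False
  define r where "r = 1 / p h1"
  have pos: "p h1 > 0" using False p_nonneg[of h1] by linarith
  hence r: "r > 0" "p h1 = 1 / r" by (simp_all add: r_def)
  let ?s = "h1 * h1 + h2 * h2 + h3 * h3 + h4 * h4"
  have "1 \<le> 10 * p (r *r h1 * r *r h1 + r *r h2 * r *r h2 + r *r h3 * r *r h3 + r *r h4 * r *r h4)"
    using le pos by (intro four_squares_normalized) (auto simp: sa star_simps p_scale r_def norm_divide)
  also have "r *r h1 * r *r h1 + r *r h2 * r *r h2 + r *r h3 * r *r h3 + r *r h4 * r *r h4
      = (r * r) *r ?s"
    by (simp add: scale_simps scale_right_distrib)
  finally have "1 \<le> 10 * p ((r * r) *r ?s)" .
  also have "p ((r * r) *r ?s) = r\<^sup>2 * p ?s" by (simp only: p_scale norm_of_real abs_mult_self_eq abs_mult power2_eq_square)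
  finally show ?thesis using r(1) unfolding r(2) by (simp add: power_divide field_simps)
qed simp

lemma four_squares:
  assumes sa: "star h1 = h1" "star h2 = h2" "star h3 = h3" "star h4 = h4"
  shows "(p h1)\<^sup>2 \<le> 10 * p (h1 * h1 + h2 * h2 + h3 * h3 + h4 * h4)"
proof -
  let ?s = "h1 * h1 + h2 * h2 + h3 * h3 + h4 * h4"
  have perm: "h2 * h2 + h1 * h1 + h3 * h3 + h4 * h4 = ?s" "h3 * h3 + h1 * h1 + h2 * h2 + h4 * h4 = ?s"
    "h4 * h4 + h1 * h1 + h2 * h2 + h3 * h3 = ?s" by (simp_all add: add_ac)
  have "\<exists>M. p h1 \<le> M \<and> M\<^sup>2 \<le> 10 * p ?s"
  proof -
    consider "p h2 \<le> p h1" "p h3 \<le> p h1" "p h4 \<le> p h1"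
      | "p h1 \<le> p h2" "p h3 \<le> p h2" "p h4 \<le> p h2"
      | "p h1 \<le> p h3" "p h2 \<le> p h3" "p h4 \<le> p h3"
      | "p h1 \<le> p h4" "p h2 \<le> p h4" "p h3 \<le> p h4" by linarith
    thus ?thesis
      by cases (use four_squares_largest[of h1 h2 h3 h4] four_squares_largest[of h2 h1 h3 h4]
        four_squares_largest[of h3 h1 h2 h4] four_squares_largest[of h4 h1 h2 h3] sa perm in auto)
  qed
  then obtain M where "p h1 \<le> M" "M\<^sup>2 \<le> 10 * p ?s" by blast
  thus ?thesis using power_mono[of "p h1" M 2] by (metis order_trans p_nonneg)
qed

text \<open>For \<open>z = \<zeta> b a\<^sup>*\<close> the squares of the self-adjoint \<open>u = z + z\<^sup>*\<close> and \<open>v = i (z - z\<^sup>*)\<close> add up to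
\<open>2 (z z\<^sup>* + z\<^sup>* z)\<close>, and \<open>\<zeta> = 1 / sqrt 2\<close> makes this equal to \<open>b a\<^sup>* a b\<^sup>* + a b\<^sup>* b a\<^sup>*\<close>. Moreover
\<open>a b\<^sup>* b a\<^sup>* = a s a\<^sup>* - (a a\<^sup>*)\<^sup>2\<close> and \<open>b a\<^sup>* a b\<^sup>* = b s b\<^sup>* - (b b\<^sup>*)\<^sup>2\<close>. So four squares of
self-adjoint elements add up to \<open>a s a\<^sup>* + b s b\<^sup>*\<close>, which is controlled by \<open>p s\<close>.\<close>

lemma positive_summand_bound:
  "p (star a * a) \<le> 10240 * p (star a * a + star b * b)"
proof -
  define s where "s = star a * a + star b * b"
  have s: "star s = s" by (simp add: s_def star_simps)
  define \<zeta> where "\<zeta> = complex_of_real (1 / sqrt 2)"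
  have \<zeta>: "cnj \<zeta> = \<zeta>" "\<zeta> * \<zeta> + \<zeta> * \<zeta> = 1" by (simp_all add: \<zeta>_def flip: of_real_mult of_real_add)
  define z where "z = scaleA \<zeta> (b * star a)"
  define u v where "u = z + star z" and "v = scaleA \<i> (z - star z)"
  define \<alpha> \<beta> where "\<alpha> = a * star a" and "\<beta> = b * star b"
  have uv: "star u = u" "star v = v" by (simp_all add: u_def v_def star_simps algebra_simps)
  have \<alpha>\<beta>: "star \<alpha> = \<alpha>" "star \<beta> = \<beta>" by (simp_all add: \<alpha>_def \<beta>_def star_simps)
  have "u * u + v * v = (z * star z + star z * z) + (z * star z + star z * z)"
    by (simp add: u_def v_def scale_simps algebra_simps)
  also have "\<dots> = b * star a * (a * star b) + a * star b * (b * star a)"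
  proof -
    have half: "scaleA (\<zeta> * \<zeta>) x + scaleA (\<zeta> * \<zeta>) x = x" for x
      using scale_left_distrib[of "\<zeta> * \<zeta>" "\<zeta> * \<zeta>" x] \<zeta> by simp
    have "z * star z = scaleA (\<zeta> * \<zeta>) (b * star a * (a * star b))"
      "star z * z = scaleA (\<zeta> * \<zeta>) (a * star b * (b * star a))"
      by (simp_all add: z_def star_simps scale_simps \<zeta>)
    thus ?thesis using half by (metis add.assoc add.left_commute)
  qed
  finally have eq: "u * u + v * v + \<alpha> * \<alpha> + \<beta> * \<beta> = a * (s * star a) + b * (s * star b)"
    by (simp add: \<alpha>_def \<beta>_def s_def algebra_simps)
  have sandwich: "p (x * (s * star x)) \<le> 16 * p s * (p (star x))\<^sup>2" for x
  proof -
    have "p (x * (s * star x)) \<le> 4 * p (star x) * p (s * star x)"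
      using polarization_bound[of "star x" "s * star x"] by (simp add: star_star)
    also have "\<dots> \<le> 4 * p (star x) * (4 * p s * p (star x))"
      by (intro mult_left_mono selfadjoint_mult_bound s) auto
    finally show ?thesis by (simp add: power2_eq_square mult_ac)
  qed
  define A B where "A = (p (star a))\<^sup>2" and "B = (p (star b))\<^sup>2"
  have "p (a * (s * star a) + b * (s * star b)) \<le> 16 * p s * (A + B)"
    using order_trans[OF triangle add_mono[OF sandwich[of a] sandwich[of b]]]
    by (simp add: A_def B_def algebra_simps)
  moreover have "(p \<alpha>)\<^sup>2 \<le> 10 * p (u * u + v * v + \<alpha> * \<alpha> + \<beta> * \<beta>)"
    "(p \<beta>)\<^sup>2 \<le> 10 * p (u * u + v * v + \<alpha> * \<alpha> + \<beta> * \<beta>)"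
    using four_squares[of \<alpha> u v \<beta>] four_squares[of \<beta> u v \<alpha>] uv \<alpha>\<beta> by (simp_all add: add_ac)
  moreover have "p \<alpha> = A" "p \<beta> = B"
    using cstar_identity[of "star a"] cstar_identity[of "star b"]
    by (simp_all add: A_def B_def \<alpha>_def \<beta>_def star_star)
  ultimately have AB: "A\<^sup>2 \<le> 160 * p s * (A + B)" "B\<^sup>2 \<le> 160 * p s * (A + B)"
    unfolding eq by simp_all
  have "A + B \<le> 640 * p s" if "A + B > 0"
  proof -
    have "(A + B) * (A + B) \<le> 2 * (A\<^sup>2 + B\<^sup>2)"
      using sum_squares_bound[of A B] by (simp add: power2_eq_square algebra_simps)
    also have "\<dots> \<le> (640 * p s) * (A + B)" using AB by simp
    finally show ?thesis using that by simp
  qed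
  moreover have "A \<ge> 0" "B \<ge> 0" by (simp_all add: A_def B_def)
  ultimately have "A \<le> 640 * p s" using p_nonneg[of s] by (cases "A + B > 0") linarith+
  have "p (star a * a) \<le> (4 * p (star a))\<^sup>2"
    unfolding cstar_identity by (intro power_mono p_le_p_star) auto
  also have "\<dots> = 16 * A" by (simp add: A_def power_mult_distrib)
  finally show ?thesis using \<open>A \<le> 640 * p s\<close> by (simp add: s_def)
qed

text \<open>In the applications \<open>F\<close>, \<open>S\<close>, \<open>S'\<close> and \<open>G\<close> are the products \<open>\<langle>f, f\<rangle>\<close>, \<open>\<langle>f, g\<rangle>\<close>, \<open>\<langle>g, f\<rangle>\<close> and \<open>\<langle>g, g\<rangle>\<close>, and the
hypothesis says that \<open>\<langle>f + cg, f + cg\<rangle>\<close> is positive. By the parallelogram law the values \<open>P\<close> at \<open>c\<close> and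
\<open>- c\<close> add up to \<open>2 F + 2 \<bar>c\<bar>\<^sup>2 G\<close>, so each of them is controlled by this sum, and so is their
difference, from which \<open>S\<close> is recovered with \<open>c\<close> proportional to \<open>1\<close> and to \<open>\<i>\<close>.\<close>

lemma cauchy_schwarz_bound:
  assumes pos: "\<And>c. positive star (F + scaleA c S + scaleA (cnj c) S' + scaleA (c * cnj c) G)"
  shows "(p S)\<^sup>2 \<le> 16 * 10240\<^sup>2 * p F * p G"
proof -
  have "(p S)\<^sup>2 \<le> 4 * (2 * 10240)\<^sup>2 * p G * p F"
  proof (rule optimize_scaling)
    fix s :: real assume s: "s > 0"
    define R where "R = (\<lambda>c. scaleA c S + scaleA (cnj c) S')"
    define P where "P = (\<lambda>c. F + R c + scaleA (c * cnj c) G)"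
    have R: "p (R w) \<le> 2 * 10240 * (s * p G + p F / s)" if w: "cmod w = 1" for w
    proof -
      define c where "c = s * w"
      have "c * cnj c = complex_of_real (s\<^sup>2)"
        using w by (simp add: c_def power2_eq_square complex_norm_square[symmetric] mult_ac)
      hence P: "P c = F + R c + s\<^sup>2 *r G" "P (- c) = F - R c + s\<^sup>2 *r G"
        by (simp_all add: P_def R_def)
      have "P c + P (- c) = (F + F) + s\<^sup>2 *r (G + G)"
        unfolding P by (simp add: scale_right_distrib algebra_simps)
      hence sum: "p (P c + P (- c)) \<le> 2 * (p F + s\<^sup>2 * p G)"
        using triangle[of "F + F" "s\<^sup>2 *r (G + G)"] by (simp add: p_double p_scale norm_power)
      have "positive star (P c)" "positive star (P (- c))"
        using pos[of c] pos[of "- c"] by (simp_all add: P_def R_def algebra_simps)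
      then obtain a b where "P c = star a * a" "P (- c) = star b * b"
        unfolding positive_def by blast
      hence "p (P c) \<le> 10240 * p (P c + P (- c))" "p (P (- c)) \<le> 10240 * p (P c + P (- c))"
        using positive_summand_bound[of a b] positive_summand_bound[of b a] by (simp_all add: add.commute)
      moreover have "2 * (s * p (R w)) \<le> p (P c) + p (P (- c))"
      proof -
        have "R c = s *r R w" by (simp add: R_def c_def scale_right_distrib)
        hence "P c - P (- c) = s *r R w + s *r R w" unfolding P by simp
        thus ?thesis using triangle_diff[of "P c" "P (- c)"] s by (simp add: p_double p_scale)
      qed
      ultimately have "s * p (R w) \<le> 2 * 10240 * (p F + s\<^sup>2 * p G)" using sum by linarith
      thus ?thesis using s by (simp add: field_simps power2_eq_square)
    qed
    have "S + S = R 1 - scaleA \<i> (R \<i>)"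
      by (simp add: R_def scale_right_distrib scale_right_diff_distrib)
    hence "2 * p S \<le> p (R 1) + p (R \<i>)"
      using triangle_diff[of "R 1" "scaleA \<i> (R \<i>)"] p_double[of S] by (simp add: p_scale)
    thus "p S \<le> 2 * 10240 * (s * p G + p F / s)" using R[of 1] R[of \<i>] by simp
  qed auto
  thus ?thesis by (simp add: mult_ac)
qed

section \<open>Resolvents of squares\<close>

text \<open>Both estimates come from \<open>(2t)\<^sup>2 + (1 - t\<^sup>2)\<^sup>2 = (1 + t\<^sup>2)\<^sup>2\<close>. They say that \<open>(1 + g\<^sup>2)\<^bsup>-1\<^esup>\<close> and
\<open>2 g (1 + g\<^sup>2)\<^bsup>-1\<^esup>\<close> are contractions, whatever the size of \<open>p g\<close>.\<close>

lemma one_plus_square_expansive: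
  assumes "star g = g"
  shows "p e \<le> p (e + g * (g * e))" and "2 * p (g * e) \<le> p (e + g * (g * e))"
proof -
  let ?a = "g * e + g * e" and ?b = "e - g * (g * e)" and ?w = "e + g * (g * e)"
  have "star ?a * ?b = star ?b * ?a" "star ?b * ?a = star ?a * ?b"
    "star ?a * ?a + star ?b * ?b = star ?w * ?w"
    by (simp_all add: star_simps assms algebra_simps)
  hence "(p ?a)\<^sup>2 \<le> (p ?w)\<^sup>2" "(p ?b)\<^sup>2 \<le> (p ?w)\<^sup>2"
    using two_squares[of ?a ?b] two_squares[of ?b ?a] by (simp_all add: cstar_identity add.commute)
  hence "p ?a \<le> p ?w" "p ?b \<le> p ?w" by (auto intro: power2_le_imp_le)
  moreover have "2 * p e \<le> p ?w + p ?b"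
    using triangle[of ?w ?b] p_double[of e] by (simp add: algebra_simps)
  ultimately show "p e \<le> p ?w" "2 * p (g * e) \<le> p ?w" by (simp_all add: p_double)
qed

lemma small_step_contraction:
  assumes "star g = g" "0 \<le> \<sigma>" "\<sigma> * (p g)\<^sup>2 \<le> 1"
  shows "p (e - \<sigma> *r (g * (g * e))) \<le> p e"
proof -
  have "(p (sqrt \<sigma> *r g))\<^sup>2 \<le> 1\<^sup>2"
    using assms by (simp add: p_scale power_mult_distrib)
  hence "p (sqrt \<sigma> *r g) \<le> 1" by (rule power2_le_imp_le) simp
  moreover have "star (sqrt \<sigma> *r g) = sqrt \<sigma> *r g" using assms by (simp add: star_simps)
  moreover have "sqrt \<sigma> *r g * (sqrt \<sigma> *r g * e) = \<sigma> *r (g * (g * e))"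
  proof -
    have "complex_of_real (sqrt \<sigma>) * complex_of_real (sqrt \<sigma>) = complex_of_real \<sigma>"
      using assms(2) by (metis of_real_mult real_sqrt_mult_self abs_of_nonneg)
    thus ?thesis by (simp add: scale_simps)
  qed
  ultimately show ?thesis
    using one_minus_square_contraction[of "sqrt \<sigma> *r g" e] assms by simp
qed

end

text \<open>A generating set that contains \<open>0\<close> may have its centre elsewhere, so continuity of \<open>p\<close> at the centre is
used. The form of \<open>cont\<close>, weaker than the triangle inequality, suits \<open>h \<mapsto> sqrt (p [h, h])\<close>, where it follows
from the Cauchy--Schwarz inequality with any constant.\<close>

lemma eventually_in_seminorm_neighbourhood:
  fixes P :: "('b::ab_group_add \<Rightarrow> real) set" and d :: "'i \<Rightarrow> 'b"
  assumes "openin (seminorm_topology P) U" "0 \<in> U"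
    and cont: "\<And>p z e. p \<in> P \<Longrightarrow> p z < e \<Longrightarrow> \<exists>\<delta>>0. \<forall>d. p d < \<delta> \<longrightarrow> p (d + z) < e"
    and small: "\<And>p \<delta>. p \<in> P \<Longrightarrow> \<delta> > 0 \<Longrightarrow> eventually (\<lambda>i. p (d i) < \<delta>) F"
  shows "eventually (\<lambda>i. d i \<in> U) F"
proof -
  have "generate_topology_on (insert UNIV {{y. p (y - x) < e} |p x e. p \<in> P \<and> e > 0}) U"
    using assms(1) by (simp add: seminorm_topology_def openin_topology_generated_by_iff)
  thus ?thesis using assms(2)
  proof (induction U rule: generate_topology_on.induct)
    case (UN K)
    then obtain V where "V \<in> K" "0 \<in> V" by blast
    with UN.IH[of V] show ?case by (auto elim: eventually_mono)
  next
    case (Basis V)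
    show ?case
    proof (cases "V = UNIV")
      case False
      then obtain p x e where V: "V = {y. p (y - x) < e}" and p: "p \<in> P" using Basis by auto
      from cont[OF p, of "- x" e] obtain \<delta> where "\<delta> > 0" "\<And>d. p d < \<delta> \<Longrightarrow> p (d - x) < e"
        using Basis V by auto
      with small[OF p, of \<delta>] show ?thesis by (auto simp: V elim: eventually_mono)
    qed simp
  qed (auto intro: eventually_conj)
qed

lemma complete_seminorm_topology_limit:
  fixes P :: "('b::ab_group_add \<Rightarrow> real) set" and x :: "nat \<Rightarrow> 'b"
  assumes complete: "complete_group_topology (seminorm_topology P)"
    and cont: "\<And>p z e. p \<in> P \<Longrightarrow> p z < e \<Longrightarrow> \<exists>\<delta>>0. \<forall>d. p d < \<delta> \<longrightarrow> p (d + z) < e"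
    and zero: "\<And>p. p \<in> P \<Longrightarrow> p 0 = 0"
    and cauchy: "\<And>p e. p \<in> P \<Longrightarrow> e > 0 \<Longrightarrow> \<exists>N. \<forall>m\<ge>N. \<forall>n\<ge>N. p (x m - x n) < e"
  shows "\<exists>l. \<forall>p\<in>P. \<forall>e>0. \<forall>\<^sub>F n in sequentially. p (x n - l) < e"
proof -
  let ?F = "filtermap x sequentially"
  have "cauchy_filter_in (seminorm_topology P) ?F"
    unfolding cauchy_filter_in_def
  proof (intro allI impI, elim conjE)
    fix U assume U: "openin (seminorm_topology P) U" "0 \<in> U"
    have small: "\<forall>\<^sub>F i in sequentially \<times>\<^sub>F sequentially. p (x (fst i) - x (snd i)) < e"
      if "p \<in> P" "e > 0" for p e
      using cauchy[OF that] unfolding eventually_prod_sequentially by fastforce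
    have "\<forall>\<^sub>F i in sequentially \<times>\<^sub>F sequentially. x (fst i) - x (snd i) \<in> U"
    proof (rule eventually_in_seminorm_neighbourhood[OF U])
      fix p z and e :: real assume "p \<in> P" "p z < e"
      thus "\<exists>\<delta>>0. \<forall>d. p d < \<delta> \<longrightarrow> p (d + z) < e" by (rule cont)
    next
      fix p and e :: real assume "p \<in> P" "e > 0"
      thus "\<forall>\<^sub>F i in sequentially \<times>\<^sub>F sequentially. p (x (fst i) - x (snd i)) < e" by (rule small)
    qed
    then obtain N where N: "\<And>m n. m \<ge> N \<Longrightarrow> n \<ge> N \<Longrightarrow> x m - x n \<in> U"
      by (auto simp: eventually_prod_sequentially)
    have "eventually (\<lambda>y. y \<in> x ` {N..}) ?F"
      by (auto simp: eventually_filtermap eventually_sequentially)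
    thus "\<forall>\<^sub>F (a, b) in ?F \<times>\<^sub>F ?F. a - b \<in> U"
      unfolding eventually_prod_same using N by blast
  qed
  moreover have "?F \<noteq> bot" by (simp add: filtermap_bot_iff)
  ultimately obtain l where l: "limitin (seminorm_topology P) (\<lambda>y. y) l ?F"
    using complete unfolding complete_group_topology_def by blast
  show ?thesis
  proof (intro exI[of _ l] ballI allI impI)
    fix p and e :: real assume pe: "p \<in> P" "e > 0"
    have "openin (seminorm_topology P) {y. p (y - l) < e}"
      using pe unfolding seminorm_topology_def by (intro topology_generated_by_Basis) blast
    moreover have "l \<in> {y. p (y - l) < e}" using pe zero[OF pe(1)] by simp
    ultimately show "\<forall>\<^sub>F n in sequentially. p (x n - l) < e"
      using l unfolding limitin_def by (auto simp: eventually_filtermap)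
  qed
qed

lemma seminorm_topology_separates:
  fixes P :: "('b::ab_group_add \<Rightarrow> real) set"
  assumes Hausdorff: "Hausdorff_space (seminorm_topology P)"
    and cont: "\<And>p z e. p \<in> P \<Longrightarrow> p z < e \<Longrightarrow> \<exists>\<delta>>0. \<forall>d. p d < \<delta> \<longrightarrow> p (d + z) < e"
    and zero: "\<And>p. p \<in> P \<Longrightarrow> p x = 0"
  shows "x = 0"
proof (rule ccontr)
  assume "x \<noteq> 0"
  have "topspace (seminorm_topology P) = UNIV" by (auto simp: seminorm_topology_def)
  with Hausdorff \<open>x \<noteq> 0\<close> obtain U V where
    UV: "openin (seminorm_topology P) U" "openin (seminorm_topology P) V" "0 \<in> U" "x \<in> V" "disjnt U V"
    unfolding Hausdorff_space_def by (metis UNIV_I)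
  have "\<forall>\<^sub>F n in sequentially. x \<in> U"
  proof (rule eventually_in_seminorm_neighbourhood[OF UV(1,3)])
    fix p z and e :: real assume "p \<in> P" "p z < e"
    thus "\<exists>\<delta>>0. \<forall>d. p d < \<delta> \<longrightarrow> p (d + z) < e" by (rule cont)
  next
    fix p and \<delta> :: real assume "p \<in> P" "\<delta> > 0"
    thus "\<forall>\<^sub>F n in sequentially. p x < \<delta>" using zero[of p] by simp
  qed
  hence "x \<in> U" by simp
  with UV show False by (auto simp: disjnt_def)
qed

context locally_cstar_algebra
begin

text \<open>The solution is the limit of the relaxation \<open>x \<mapsto> x + \<tau> (k - (1 + g\<^sup>2) x)\<close>. One step multiplies the residual
by \<open>(1 - \<tau>) (1 - \<sigma> g\<^sup>2)\<close> with \<open>\<sigma> = \<tau> / (1 - \<tau>)\<close>, where the second factor is a contraction once \<open>\<sigma> * (p g)\<^sup>2 \<le> 1\<close>.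
The values \<open>p g\<close> for the various generating seminorms \<open>p\<close> need not be bounded; therefore the steps
\<open>\<tau> = 1 / (n + 2)\<close> tend to \<open>0\<close>, and since their sum diverges, all residuals still tend to \<open>0\<close>.\<close>

lemma one_plus_square_surjective:
  assumes g: "star g = g"
  shows "\<exists>e. e + g * (g * e) = k"
proof -
  obtain P where P: "\<And>p. p \<in> P \<Longrightarrow> cstar_seminorm scaleA star p" and T: "T = seminorm_topology P"
    using induced_by_cstar_seminorms by blast
  have alg: "cstar_seminormed_algebra scaleA star p" if "p \<in> P" for p
    using P[OF that] by unfold_locales
  have cont: "\<exists>\<delta>>0. \<forall>d. p d < \<delta> \<longrightarrow> p (d + z) < e" if "p \<in> P" "p z < e" for p z e
  proof (intro exI[of _ "e - p z"] conjI allI impI)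
    interpret cstar_seminormed_algebra scaleA star p by (rule alg) fact
    fix d assume "p d < e - p z" thus "p (d + z) < e" using triangle[of d z] by simp
  qed (use that in simp)
  define x where "x = rec_nat 0 (\<lambda>n y. y + (1 / (real n + 2)) *r (k - y - g * (g * y)))"
  define r where "r = (\<lambda>n. k - x n - g * (g * x n))"
  have x_Suc: "x (Suc n) = x n + (1 / (real n + 2)) *r r n" for n
    by (simp add: x_def r_def)
  have r_Suc: "r (Suc n) = ((real n + 1) / (real n + 2)) *r (r n - (1 / (real n + 1)) *r (g * (g * r n)))" for n
  proof -
    define t where "t = 1 / (real n + 2)"
    have t: "(real n + 1) / (real n + 2) = 1 - t" "(1 - t) * (1 / (real n + 1)) = t"
      by (simp_all add: t_def field_simps)
    have "r (Suc n) = r n - t *r r n - t *r (g * (g * r n))"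
      unfolding r_def x_Suc t_def by (simp add: scale_simps algebra_simps)
    also have "\<dots> = (1 - t) *r r n - ((1 - t) * (1 / (real n + 1))) *r (g * (g * r n))"
      unfolding t(2) by (simp add: scale_left_diff_distrib)
    also have "\<dots> = (1 - t) *r (r n - (1 / (real n + 1)) *r (g * (g * r n)))"
      by (simp add: scale_right_diff_distrib)
    finally show ?thesis unfolding t(1) .
  qed
  have residual: "(\<lambda>n. p (r n)) \<longlonglongrightarrow> 0" if "p \<in> P" for p
  proof -
    interpret cstar_seminormed_algebra scaleA star p by (rule alg) fact
    obtain N :: nat where N: "(p g)\<^sup>2 \<le> real N" using real_arch_simple by blast
    define C where "C = (real N + 1) * p (r N)"
    have "(real n + 1) * p (r n) \<le> C" if "n \<ge> N" for n
      using that
    proof (induction n rule: dec_induct)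
      case (step n)
      have "1 / (real n + 1) * (p g)\<^sup>2 \<le> 1"
        using N step(1) by (simp add: field_simps)
      hence "p (r n - (1 / (real n + 1)) *r (g * (g * r n))) \<le> p (r n)"
        by (intro small_step_contraction g) auto
      hence "(real n + 1) / (real n + 2) * p (r n - (1 / (real n + 1)) *r (g * (g * r n)))
          \<le> (real n + 1) / (real n + 2) * p (r n)" by (intro mult_left_mono) auto
      also have "(real n + 1) / (real n + 2) * p (r n - (1 / (real n + 1)) *r (g * (g * r n))) = p (r (Suc n))"
        unfolding r_Suc p_scale norm_of_real by simp
      finally have "(real n + 2) * p (r (Suc n)) \<le> (real n + 1) * p (r n)"
        by (simp add: field_simps)
      with step.IH show ?case by (simp add: algebra_simps)
    qed (simp add: C_def)
    hence "p (r n) \<le> C / (real n + 1)" if "n \<ge> N" for n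
      using that by (simp add: field_simps)
    hence "\<forall>\<^sub>F n in sequentially. p (r n) \<le> C / (real n + 1)"
      by (auto simp: eventually_sequentially)
    moreover have "(\<lambda>n. C / (real n + 1)) \<longlonglongrightarrow> 0" by real_asymp
    ultimately show ?thesis
      by (rule tendsto_sandwich[OF always_eventually[OF allI[OF p_nonneg]] _ tendsto_const])
  qed
  have cauchy: "\<exists>N. \<forall>m\<ge>N. \<forall>n\<ge>N. p (x m - x n) < e" if "p \<in> P" "e > 0" for p e
  proof -
    interpret cstar_seminormed_algebra scaleA star p by (rule alg) fact
    have "\<forall>\<^sub>F n in sequentially. p (r n) < e / 2"
      using order_tendstoD(2)[OF residual[OF that(1)], of "e / 2"] that by simp
    then obtain N where N: "\<And>n. n \<ge> N \<Longrightarrow> p (r n) < e / 2" by (auto simp: eventually_sequentially)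
    have "p (x m - x n) < e" if "m \<ge> N" "n \<ge> N" for m n
    proof -
      have "(x m - x n) + g * (g * (x m - x n)) = r n - r m" by (simp add: r_def algebra_simps)
      hence "p (x m - x n) \<le> p (r n) + p (r m)"
        using one_plus_square_expansive(1)[OF g, of "x m - x n"] triangle_diff[of "r n" "r m"] by simp
      thus ?thesis using N[OF that(1)] N[OF that(2)] by simp
    qed
    thus ?thesis by blast
  qed
  have "\<exists>l. \<forall>p\<in>P. \<forall>e>0. \<forall>\<^sub>F n in sequentially. p (x n - l) < e"
  proof (rule complete_seminorm_topology_limit)
    show "complete_group_topology (seminorm_topology P)" using complete unfolding T .
    show "p 0 = 0" if "p \<in> P" for p
      by (rule cstar_seminormed_algebra.p_zero[OF alg[OF that]])
  qed (fact cont cauchy)+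
  then obtain l where l: "\<And>p e. p \<in> P \<Longrightarrow> e > 0 \<Longrightarrow> \<forall>\<^sub>F n in sequentially. p (x n - l) < e"
    by blast
  have "k - l - g * (g * l) = 0"
  proof (rule seminorm_topology_separates[of P])
    fix p assume p: "p \<in> P"
    interpret cstar_seminormed_algebra scaleA star p by (rule alg) fact
    define D where "D = 1 + 16 * p g * (16 * p g)"
    have D: "D > 0" unfolding D_def by (intro add_pos_nonneg) auto
    have "(\<lambda>n. p (x n - l)) \<longlonglongrightarrow> 0"
      using l[OF p] by (auto intro!: order_tendstoI simp: less_le_trans[OF _ p_nonneg])
    hence "(\<lambda>n. p (r n) + D * p (x n - l)) \<longlonglongrightarrow> 0 + D * 0"
      by (intro tendsto_intros residual p)
    moreover have "p (k - l - g * (g * l)) \<le> p (r n) + D * p (x n - l)" for n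
    proof -
      have "k - l - g * (g * l) = r n + ((x n - l) + g * (g * (x n - l)))"
        by (simp add: r_def algebra_simps)
      moreover have "p (g * (g * (x n - l))) \<le> 16 * p g * (16 * p g * p (x n - l))"
        by (intro order_trans[OF mult_bound] mult_left_mono mult_bound) auto
      ultimately show ?thesis
        using triangle[of "r n" "(x n - l) + g * (g * (x n - l))"] triangle[of "x n - l" "g * (g * (x n - l))"]
        by (simp add: D_def algebra_simps)
    qed
    ultimately have "p (k - l - g * (g * l)) \<le> 0"
      by (intro LIMSEQ_le_const[where X = "\<lambda>n. p (r n) + D * p (x n - l)"]) auto
    thus "p (k - l - g * (g * l)) = 0" using p_nonneg[of "k - l - g * (g * l)"] by linarith
  qed (use Hausdorff T in simp, fact cont)
  hence "l + g * (g * l) = k" by (simp add: algebra_simps)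
  thus ?thesis ..
qed

end

section \<open>The gramian\<close>

context hilbert_module
begin

lemma gram_add_right: "gram e (f + g) = gram e f + gram e g"
  and gram_scale_right: "gram e (scaleH c f) = scaleA c (gram e f)"
  and gram_zero_right [simp]: "gram e 0 = 0"
  and gram_diff_right: "gram e (f - g) = gram e f - gram e g"
  and gram_sum_right: "gram e (\<Sum>i\<in>I. w i) = (\<Sum>i\<in>I. gram e (w i))"
proof -
  interpret gl: Vector_Spaces.linear scaleH scaleA "gram e" by (rule gram_linear)
  show "gram e (f + g) = gram e f + gram e g" by (rule gl.add)
  show "gram e (scaleH c f) = scaleA c (gram e f)" by (rule gl.scale)
  show "gram e 0 = 0" by (rule gl.zero)
  show "gram e (f - g) = gram e f - gram e g" by (rule gl.diff)
  show "gram e (\<Sum>i\<in>I. w i) = (\<Sum>i\<in>I. gram e (w i))" by (rule gl.sum)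
qed

lemma gram_add_left: "gram (f + g) e = gram f e + gram g e"
  by (subst (1 2 3) gram_star) (simp add: gram_add_right star_add)

lemma gram_diff_left: "gram (f - g) e = gram f e - gram g e"
  by (subst (1 2 3) gram_star) (simp add: gram_diff_right star_diff)

lemma gram_scale_left: "gram (scaleH c f) e = scaleA (cnj c) (gram f e)"
  by (subst (1 2) gram_star) (simp add: gram_scale_right star_scale)

lemma gram_sum_left: "gram (\<Sum>i\<in>I. w i) e = (\<Sum>i\<in>I. gram (w i) e)"
  by (subst (1 2) gram_star) (simp add: gram_sum_right star_sum)

lemma gram_act_right: "gram e (act f a) = gram e f * a"
proof -
  have "act 0 b = 0" for b using act_add_left[of 0 0 b] by simp
  thus ?thesis using gram_act[of e f a 0 0] by simp
qed

lemma gram_act_left: "gram (act f a) e = star a * gram f e"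
  by (subst (1 2) gram_star) (simp add: gram_act_right star_mult)

lemma gram_cauchy_schwarz:
  assumes "cstar_seminorm scaleA star q"
  shows "q (gram f g) \<le> 40960 * sqrt (q (gram f f)) * sqrt (q (gram g g))"
proof -
  interpret cstar_seminormed_algebra scaleA star q using assms by unfold_locales
  have "(q (gram f g))\<^sup>2 \<le> 16 * 10240\<^sup>2 * q (gram f f) * q (gram g g)"
  proof (rule cauchy_schwarz_bound)
    fix c
    have "gram (f + scaleH c g) (f + scaleH c g)
        = gram f f + scaleA c (gram f g) + scaleA (cnj c) (gram g f) + scaleA (c * cnj c) (gram g g)"
      by (simp add: gram_add_left gram_add_right gram_scale_left gram_scale_right algebra_simps)
    thus "positive star (gram f f + scaleA c (gram f g) + scaleA (cnj c) (gram g f)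
        + scaleA (c * cnj c) (gram g g))"
      using gram_positive[of "f + scaleH c g"] by simp
  qed
  also have "\<dots> = (40960 * sqrt (q (gram f f)) * sqrt (q (gram g g)))\<^sup>2"
    by (simp add: power_mult_distrib)
  finally show ?thesis by (rule power2_le_imp_le) simp
qed

text \<open>All \<open>C\<^sup>*\<close>-seminorms are admitted here, also discontinuous ones, since the estimates are algebraic.\<close>

definition simultaneous_unit_ball :: "'h set" where
  "simultaneous_unit_ball = {u. \<forall>q. cstar_seminorm scaleA star q \<longrightarrow> q (gram u u) \<le> 1}"

text \<open>With \<open>g = [u, u]\<close> the vector is \<open>u' = u (1 + g\<^sup>2)\<^bsup>-1\<^esup>\<close>, written as \<open>u - u m\<close> with \<open>m = g\<^sup>2 (1 + g\<^sup>2)\<^bsup>-1\<^esup>\<close> in the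
algebra. Then \<open>[u', u'] = (1 - m) g (1 - m)\<close>, and \<open>t / (1 + t\<^sup>2)\<^sup>2\<close> is bounded on the whole real line. The
square of \<open>g\<close> makes this bound accessible through squares of self-adjoint elements.\<close>

lemma ex_simultaneously_bounded:
  obtains u' where "u' \<in> simultaneous_unit_ball"
    and "u = u' + act u' (gram u u * gram u u)"
proof -
  define g where "g = gram u u"
  have g: "star g = g" unfolding g_def by (metis gram_star)
  obtain m where m: "m + g * (g * m) = g * g"
    using one_plus_square_surjective[OF g, of "g * g"] by blast
  have m': "star m + star m * (g * g) = g * g"
    using arg_cong[OF m, of star] by (simp add: star_simps g mult.assoc)
  (* Both sides of this chain evaluate m^* (1 + g^2) m, which shows that m is self-adjoint. *)
  have "star m * (g * g) = star m * (m + g * (g * m))" using m by simp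
  also have "\<dots> = (star m + star m * (g * g)) * m" by (simp add: algebra_simps)
  also have "\<dots> = g * (g * m)" unfolding m' by (simp add: mult.assoc)
  finally have mm: "star m = m" using m m' by (metis add_right_cancel)
  define u' where "u' = u - act u m"
  have act_diff_left: "act (e - f) a = act e a - act f a" for e f a
    using act_add_left[of "e - f" f a] by simp
  have "u' + act u' (g * g) = u - act u m + (act u (g * g) - act u (m * (g * g)))"
    by (simp add: u'_def act_diff_left act_act)
  also have "act u (g * g) = act u m + act u (m * (g * g))"
    using m' unfolding mm by (metis act_add_right)
  finally have u: "u = u' + act u' (g * g)" by simp
  have "q (gram u' u') \<le> 1" if "cstar_seminorm scaleA star q" for q
  proof -
    interpret cstar_seminormed_algebra scaleA star q using that by unfold_locales
    define G where "G = gram u' u'"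
    have "star G = G" unfolding G_def by (metis gram_star)
    have resolvent: "(e - m * e) + g * (g * (e - m * e)) = e" for e
    proof -
      have "(e - m * e) + g * (g * (e - m * e)) = e + g * (g * e) - (m + g * (g * m)) * e"
        by (simp add: algebra_simps)
      thus ?thesis unfolding m by (simp add: mult.assoc)
    qed
    have "G * G = g * (G - m * G) - m * (g * (G - m * G))"
    proof -
      have G: "G = g - g * m - m * g + m * (g * m)"
        by (simp add: G_def u'_def gram_diff_left gram_diff_right gram_act_left gram_act_right mm
            algebra_simps flip: g_def)
      have "G * e = g * (e - m * e) - m * (g * (e - m * e))" for e
        unfolding G by (simp add: algebra_simps)
      thus ?thesis .
    qed
    hence "q (G * G) \<le> q (g * (G - m * G))"
      using one_plus_square_expansive(1)[OF g, of "g * (G - m * G) - m * (g * (G - m * G))"]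
      by (simp only: resolvent)
    moreover have "2 * q (g * (G - m * G)) \<le> q G"
      using one_plus_square_expansive(2)[OF g, of "G - m * G"] by (simp only: resolvent)
    ultimately have "q G * q G \<le> q G * 1"
      using selfadjoint_square[OF \<open>star G = G\<close>] p_nonneg[of G] unfolding power2_eq_square by linarith
    thus ?thesis unfolding G_def[symmetric] using p_nonneg[of G]
      by (metis mult_le_cancel_left_pos order_le_less zero_le_one)
  qed
  hence "u' \<in> simultaneous_unit_ball" by (simp add: simultaneous_unit_ball_def)
  with u show ?thesis using that unfolding g_def by blast
qed

section \<open>Boundedness of adjointable operators\<close>

text \<open>The Cauchy--Schwarz inequality with a constant gives the triangle inequality for \<open>h \<mapsto> sqrt (q [h, h])\<close> with a
constant, which would accumulate in long sums; expanding the gramian of the whole sum keeps a single constant.\<close>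

lemma gram_sum_bound:
  assumes "cstar_seminorm scaleA star q" and "\<And>j. j \<in> J \<Longrightarrow> f j \<in> simultaneous_unit_ball"
  shows "q (gram (\<Sum>j\<in>J. scaleH (complex_of_real (\<epsilon> j)) (f j)) (\<Sum>j\<in>J. scaleH (complex_of_real (\<epsilon> j)) (f j)))
    \<le> 40960 * (\<Sum>j\<in>J. \<bar>\<epsilon> j\<bar>)\<^sup>2"
proof -
  interpret cstar_seminormed_algebra scaleA star q using assms(1) by unfold_locales
  have ball: "q (gram (f i) (f j)) \<le> 40960" if "i \<in> J" "j \<in> J" for i j
  proof -
    have "sqrt (q (gram (f i) (f i))) * sqrt (q (gram (f j) (f j))) \<le> 1 * 1"
      using assms that by (intro mult_mono) (auto simp: simultaneous_unit_ball_def)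
    thus ?thesis using gram_cauchy_schwarz[OF assms(1), of "f i" "f j"] by simp
  qed
  let ?s = "\<Sum>j\<in>J. scaleH (complex_of_real (\<epsilon> j)) (f j)"
  have "q (gram ?s ?s) = q (\<Sum>i\<in>J. \<Sum>j\<in>J. scaleA (complex_of_real (\<epsilon> i * \<epsilon> j)) (gram (f i) (f j)))"
    by (simp only: gram_sum_left)
       (simp add: gram_sum_right gram_scale_left gram_scale_right scale_sum_right mult.commute)
  also have "\<dots> \<le> (\<Sum>i\<in>J. \<Sum>j\<in>J. q (scaleA (complex_of_real (\<epsilon> i * \<epsilon> j)) (gram (f i) (f j))))"
    by (intro order_trans[OF p_sum] sum_mono p_sum)
  also have "\<dots> \<le> (\<Sum>i\<in>J. \<Sum>j\<in>J. (\<bar>\<epsilon> i\<bar> * \<bar>\<epsilon> j\<bar>) * 40960)"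
    by (intro sum_mono) (simp only: p_scale norm_of_real abs_mult, intro mult_left_mono ball, auto)
  also have "\<dots> = 40960 * (\<Sum>j\<in>J. \<bar>\<epsilon> j\<bar>)\<^sup>2"
    unfolding power2_eq_square sum_product by (simp only: sum_distrib_right[symmetric] mult.commute)
  finally show ?thesis .
qed

lemma module_sequence_limit:
  assumes cauchy: "\<And>q e. q \<in> continuous_cstar_seminorms scaleA star T \<Longrightarrow> e > 0 \<Longrightarrow>
    \<exists>N. \<forall>m\<ge>N. \<forall>n\<ge>N. sqrt (q (gram (x m - x n) (x m - x n))) < e"
  shows "\<exists>l. \<forall>q\<in>continuous_cstar_seminorms scaleA star T. \<forall>e>0.
    \<forall>\<^sub>F n in sequentially. sqrt (q (gram (x n - l) (x n - l))) < e"
proof -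
  let ?P = "(\<lambda>p h. sqrt (p (gram h h))) ` continuous_cstar_seminorms scaleA star T"
  have "\<exists>l. \<forall>p\<in>?P. \<forall>e>0. \<forall>\<^sub>F n in sequentially. p (x n - l) < e"
  proof (rule complete_seminorm_topology_limit)
    show "complete_group_topology (seminorm_topology ?P)" by (rule complete_module)
  next
    fix p z and e :: real assume "p \<in> ?P" and less: "p z < e"
    then obtain q where q: "cstar_seminorm scaleA star q" and p: "p = (\<lambda>h. sqrt (q (gram h h)))"
      by (auto simp: continuous_cstar_seminorms_def)
    interpret cstar_seminormed_algebra scaleA star q using q by unfold_locales
    define a where "a = p z"
    have p_sq: "q (gram h h) = (p h)\<^sup>2" for h by (simp add: p)
    have pos: "p h \<ge> 0" for h by (simp add: p)
    define \<delta> where "\<delta> = min 1 ((e\<^sup>2 - a\<^sup>2) / (81920 * a + 1))"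
    have a: "0 \<le> a" "a < e" using less pos by (simp_all add: a_def)
    hence "a\<^sup>2 < e\<^sup>2" by (intro power_strict_mono) auto
    hence \<delta>: "\<delta> > 0" using a by (simp add: \<delta>_def)
    have "p (d + z) < e" if "p d < \<delta>" for d
    proof -
      have "q (gram (d + z) (d + z)) = q (gram d d + gram d z + gram z d + gram z z)"
        by (simp add: gram_add_left gram_add_right add_ac)
      also have "\<dots> \<le> q (gram d d) + q (gram d z) + q (gram z d) + q (gram z z)"
        by (intro order_trans[OF triangle] add_mono order_refl)
      also have "\<dots> \<le> (p d)\<^sup>2 + 40960 * p d * a + 40960 * a * p d + a\<^sup>2"
      proof -
        have "q (gram d z) \<le> 40960 * p d * a" "q (gram z d) \<le> 40960 * a * p d"
          using gram_cauchy_schwarz[OF q, of d z] gram_cauchy_schwarz[OF q, of z d]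
          by (simp_all only: p a_def)
        thus ?thesis using p_sq[of d] p_sq[of z] unfolding a_def by linarith
      qed
      also have "\<dots> = p d * (p d + 81920 * a) + a\<^sup>2" by (simp add: power2_eq_square algebra_simps)
      also have "\<dots> \<le> p d * (1 + 81920 * a) + a\<^sup>2"
        using that pos[of d] by (intro add_mono mult_left_mono) (auto simp: \<delta>_def)
      also have "\<dots> < (e\<^sup>2 - a\<^sup>2) / (81920 * a + 1) * (1 + 81920 * a) + a\<^sup>2"
      proof (intro add_strict_right_mono mult_strict_right_mono)
        show "p d < (e\<^sup>2 - a\<^sup>2) / (81920 * a + 1)" using that by (simp add: \<delta>_def)
      qed (use a in simp)
      also have "\<dots> = e\<^sup>2"
        using a nonzero_eq_divide_eq[of "81920 * a + 1" "(e\<^sup>2 - a\<^sup>2) / (81920 * a + 1)" "e\<^sup>2 - a\<^sup>2"]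
        by (simp only: add.commute[of 1]) simp
      finally have "(p (d + z))\<^sup>2 < e\<^sup>2" unfolding p_sq .
      thus ?thesis by (rule power2_less_imp_less) (use a in linarith)
    qed
    thus "\<exists>\<delta>>0. \<forall>d. p d < \<delta> \<longrightarrow> p (d + z) < e" using \<delta> by blast
  next
    fix p assume "p \<in> ?P"
    then obtain q where q: "cstar_seminorm scaleA star q" and p: "p = (\<lambda>h. sqrt (q (gram h h)))"
      by (auto simp: continuous_cstar_seminorms_def)
    interpret cstar_seminormed_algebra scaleA star q using q by unfold_locales
    show "p 0 = 0" by (simp add: p)
  next
    fix p and e :: real assume "p \<in> ?P" "e > 0"
    thus "\<exists>N. \<forall>m\<ge>N. \<forall>n\<ge>N. p (x m - x n) < e" using cauchy by auto
  qed
  thus ?thesis by auto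
qed

end

lemma geometric_tail:
  "n \<le> m \<Longrightarrow> (\<Sum>j=n..<m. (1/3::real) ^ j) = 3/2 * ((1/3) ^ n - (1/3) ^ m)"
  by (induction m rule: dec_induct) simp_all

lemma geometric_tail_le: "(\<Sum>j=n..<m. (1/3::real) ^ j) \<le> 3/2 * (1/3) ^ n"
proof (cases "n \<le> m")
  case True
  thus ?thesis unfolding geometric_tail[OF True] by (simp add: right_diff_distrib)
qed simp

context hilbert_module
begin

text \<open>This is a gliding hump argument in the form of Sokal's proof of the uniform boundedness theorem. If
the claim fails, there are \<open>u\<^sub>n\<close> in the ball such that the functionals \<open>t\<^sub>n = p [K u\<^sub>n, -]\<close> have norms
\<open>S\<^sub>n > n 3\<^sup>n\<close> on the ball. Choose \<open>h\<^sub>n\<close> in the ball that nearly attains \<open>S\<^sub>n\<close>, and signs such that the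
partial sums of \<open>\<Sum>n. \<plusminus> 3\<^bsup>-n\<^esup> h\<^sub>n\<close> stay large under \<open>t\<^sub>n\<close> after step \<open>n\<close>; the later terms contribute at most
\<open>3\<^bsup>-n\<^esup> S\<^sub>n / 2\<close>. So \<open>t\<^sub>n\<close> at the limit \<open>l\<close> is unbounded in \<open>n\<close>, whereas \<open>t\<^sub>n l = p [u\<^sub>n, L l]\<close> is bounded by
Cauchy--Schwarz, where \<open>L\<close> is the adjoint of \<open>K\<close>.\<close>

lemma adjointable_bounded_on_ball:
  assumes p: "p \<in> continuous_cstar_seminorms scaleA star T"
    and adj: "\<And>h k. gram (K h) k = gram h (L k)"
  shows "\<exists>M. \<forall>u\<in>simultaneous_unit_ball. p (gram (K u) u) \<le> M"
proof (rule ccontr)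
  have cstar: "cstar_seminorm scaleA star p" using p by (simp add: continuous_cstar_seminorms_def)
  interpret cstar_seminormed_algebra scaleA star p using cstar by unfold_locales
  let ?B = simultaneous_unit_ball
  assume "\<nexists>M. \<forall>u\<in>?B. p (gram (K u) u) \<le> M"
  hence "\<forall>n::nat. \<exists>u\<in>?B. p (gram (K u) u) > real n * 3 ^ n" by (metis not_le)
  then obtain u where u: "\<And>n. u n \<in> ?B" "\<And>n::nat. p (gram (K (u n)) (u n)) > real n * 3 ^ n"
    by metis
  define t where "t = (\<lambda>n h. p (gram (K (u n)) h))"
  define S where "S = (\<lambda>n. SUP h\<in>?B. t n h)"
  have t_schwarz: "t n h \<le> 40960 * sqrt (p (gram (K (u n)) (K (u n)))) * sqrt (p (gram h h))" for n h
    unfolding t_def by (rule gram_cauchy_schwarz[OF cstar])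
  have t_bdd: "bdd_above (t n ` ?B)" for n
  proof (rule bdd_aboveI2)
    fix h assume "h \<in> ?B"
    hence "sqrt (p (gram h h)) \<le> 1" using cstar by (simp add: simultaneous_unit_ball_def)
    thus "t n h \<le> 40960 * sqrt (p (gram (K (u n)) (K (u n)))) * 1"
      by (intro order_trans[OF t_schwarz] mult_left_mono) auto
  qed
  have t_le_S: "t n h \<le> S n" if "h \<in> ?B" for n h
    unfolding S_def by (rule cSUP_upper[OF that t_bdd])
  have t_triangle: "t n (h + k) \<le> t n h + t n k" "t n (scaleH c h) = cmod c * t n h" for n h k c
    by (simp_all add: t_def gram_add_right gram_scale_right triangle p_scale)
  have S_large: "S n > real n * 3 ^ n" for n
    using u t_le_S[of "u n" n] by (auto simp: t_def intro: less_le_trans)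
  hence S_pos: "S n > 0" for n
    by (metis le_less_trans mult_nonneg_nonneg of_nat_0_le_iff zero_le_numeral zero_le_power)
  have "\<exists>h\<in>?B. 3/4 * S n < t n h" for n
  proof -
    have "3/4 * S n < (SUP h\<in>?B. t n h)" using S_pos[of n] by (simp add: S_def)
    thus ?thesis using less_cSUP_iff[OF _ t_bdd, of "3/4 * S n" n] u by auto
  qed
  then obtain h where h: "\<And>n. h n \<in> ?B" "\<And>n. 3/4 * S n < t n (h n)" by metis
  have step: "\<exists>\<epsilon>. \<bar>\<epsilon>\<bar> = (1/3) ^ n \<and> (1/3) ^ n * t n (h n) \<le> t n (x + scaleH (complex_of_real \<epsilon>) (h n))"
    for n x
  proof -
    let ?e = "(1/3::real) ^ n"
    let ?p = "x + scaleH (complex_of_real ?e) (h n)" and ?m = "x + scaleH (complex_of_real (- ?e)) (h n)"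
    (* One of the two signs works because 2 * 3^(-n) * h n is the difference of the two candidates. *)
    have "scaleH (complex_of_real (2 * ?e)) (h n) = ?p + scaleH (- 1) ?m"
    proof -
      have "complex_of_real (2 * ?e) = complex_of_real ?e + complex_of_real ?e" by simp
      thus ?thesis by (simp only: H.scale_left_distrib) (simp add: H.scale_right_distrib)
    qed
    hence "2 * (?e * t n (h n)) \<le> t n ?p + t n ?m"
      using t_triangle(1)[of n ?p "scaleH (- 1) ?m"] t_triangle(2)[of n "complex_of_real (2 * ?e)" "h n"]
        t_triangle(2)[of n "- 1" ?m] by (simp only: norm_of_real) (simp add: norm_power)
    hence "?e * t n (h n) \<le> t n ?p \<or> ?e * t n (h n) \<le> t n ?m" by linarith
    thus ?thesis by (metis abs_minus_cancel abs_of_nonneg zero_le_power zero_le_divide_1_iff zero_le_numeral)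
  qed
  have "\<exists>x. \<forall>n. True \<and> (\<exists>\<epsilon>. \<bar>\<epsilon>\<bar> = (1/3) ^ n
      \<and> x (Suc n) = x n + scaleH (complex_of_real \<epsilon>) (h n) \<and> (1/3) ^ n * t n (h n) \<le> t n (x (Suc n)))"
    by (rule dependent_nat_choice) (use step in blast)+
  then obtain x \<epsilon> where \<epsilon>: "\<And>n. \<bar>\<epsilon> n\<bar> = (1/3) ^ n"
    and x_Suc: "\<And>n. x (Suc n) = x n + scaleH (complex_of_real (\<epsilon> n)) (h n)"
    and x_large: "\<And>n. (1/3) ^ n * t n (h n) \<le> t n (x (Suc n))" by metis
  have x_diff: "x m - x n = (\<Sum>j=n..<m. scaleH (complex_of_real (\<epsilon> j)) (h j))" if "n \<le> m" for n m
    using that by (induction m rule: dec_induct) (simp_all add: x_Suc algebra_simps)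
  have small: "q (gram (x m - x n) (x m - x n)) \<le> 40960 * (3/2 * (1/3) ^ n)\<^sup>2"
    if "n \<le> m" "cstar_seminorm scaleA star q" for q n m
  proof -
    have "q (gram (x m - x n) (x m - x n)) \<le> 40960 * (\<Sum>j=n..<m. \<bar>\<epsilon> j\<bar>)\<^sup>2"
      unfolding x_diff[OF that(1)] by (rule gram_sum_bound[OF that(2)]) (rule h)
    also have "\<dots> \<le> 40960 * (3/2 * (1/3) ^ n)\<^sup>2"
      unfolding \<epsilon> by (intro mult_left_mono power_mono geometric_tail_le sum_nonneg) auto
    finally show ?thesis .
  qed
  have "\<exists>l. \<forall>q\<in>continuous_cstar_seminorms scaleA star T. \<forall>e>0.
    \<forall>\<^sub>F n in sequentially. sqrt (q (gram (x n - l) (x n - l))) < e"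
  proof (rule module_sequence_limit)
    fix q and e :: real assume q: "q \<in> continuous_cstar_seminorms scaleA star T" and e: "e > 0"
    hence cq: "cstar_seminorm scaleA star q" by (simp add: continuous_cstar_seminorms_def)
    have "(\<lambda>n. 40960 * (3/2 * (1/3) ^ n)\<^sup>2 :: real) \<longlonglongrightarrow> 0" by real_asymp
    hence "\<forall>\<^sub>F n in sequentially. 40960 * (3/2 * (1/3) ^ n)\<^sup>2 < e\<^sup>2"
      by (rule order_tendstoD(2)) (use e in simp)
    then obtain N where N: "\<And>n. n \<ge> N \<Longrightarrow> 40960 * (3/2 * (1/3) ^ n)\<^sup>2 < e\<^sup>2"
      by (auto simp: eventually_sequentially)
    have *: "sqrt (q (gram (x m - x n) (x m - x n))) < e" if "n \<ge> N" "n \<le> m" for m n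
      using small[OF that(2) cq] N[OF that(1)] e by (intro real_less_lsqrt) auto
    have sym: "gram (x m - x n) (x m - x n) = gram (x n - x m) (x n - x m)" for m n
      by (simp add: gram_diff_left gram_diff_right)
    have "sqrt (q (gram (x m - x n) (x m - x n))) < e" if "n \<ge> N" "m \<ge> N" for m n
      using *[of n m] *[of m n] sym[of m n] that by (cases "n \<le> m") auto
    thus "\<exists>N. \<forall>m\<ge>N. \<forall>n\<ge>N. sqrt (q (gram (x m - x n) (x m - x n))) < e" by blast
  qed
  then obtain l where l: "\<And>e. e > 0 \<Longrightarrow> \<forall>\<^sub>F n in sequentially. sqrt (p (gram (x n - l) (x n - l))) < e"
    using p by blast
  have t_limit: "1/4 * (1/3) ^ n * S n \<le> t n l" for n
  proof (rule field_le_epsilon)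
    fix e :: real assume e: "e > 0"
    define C where "C = 40960 * sqrt (p (gram (K (u n)) (K (u n)))) + 1"
    have C: "C > 0" unfolding C_def by (intro add_nonneg_pos) auto
    have "\<forall>\<^sub>F m in sequentially. sqrt (p (gram (x m - l) (x m - l))) < e / C" using l e C by simp
    then obtain m where m: "m \<ge> Suc n" "sqrt (p (gram (x m - l) (x m - l))) < e / C"
      using eventually_happens'[OF sequentially_bot eventually_conj[OF eventually_ge_at_top[of "Suc n"]]]
      by blast
    have "t n (x m - l) \<le> C * sqrt (p (gram (x m - l) (x m - l)))"
      by (intro order_trans[OF t_schwarz] mult_right_mono) (auto simp: C_def)
    also have "\<dots> \<le> C * (e / C)" using m C by (intro mult_left_mono) auto
    finally have near: "t n (x m - l) \<le> e" using C by simp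
    have "t n (x m - x (Suc n)) \<le> (\<Sum>j=Suc n..<m. t n (scaleH (complex_of_real (\<epsilon> j)) (h j)))"
      unfolding x_diff[OF m(1)] t_def gram_sum_right by (rule p_sum)
    also have "\<dots> \<le> (\<Sum>j=Suc n..<m. (1/3) ^ j * S n)"
      unfolding t_triangle(2) norm_of_real \<epsilon> by (intro sum_mono mult_left_mono t_le_S h) auto
    also have "\<dots> \<le> 3/2 * (1/3) ^ Suc n * S n"
      unfolding sum_distrib_right[symmetric]
      using S_pos[of n] by (intro mult_right_mono geometric_tail_le) auto
    finally have tail: "t n (x m - x (Suc n)) \<le> 1/2 * ((1/3) ^ n * S n)" by simp
    have t_minus: "t n (- y) = t n y" for y
      using t_triangle(2)[of n "- 1" y] by simp
    have "t n (x (Suc n)) \<le> t n l + t n (x m - l) + t n (x m - x (Suc n))"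
      using t_triangle(1)[of n "l + (x m - l)" "- (x m - x (Suc n))"] t_triangle(1)[of n l "x m - l"]
        t_minus[of "x m - x (Suc n)"] by simp
    moreover have "3/4 * ((1/3) ^ n * S n) \<le> t n (x (Suc n))"
    proof -
      have "(1/3) ^ n * (3/4 * S n) \<le> (1/3) ^ n * t n (h n)"
        using h(2)[of n] by (intro mult_left_mono) auto
      also note x_large[of n]
      finally show ?thesis by (simp only: mult.left_commute)
    qed
    ultimately show "1/4 * (1/3) ^ n * S n \<le> t n l + e"
      using near tail by linarith
  qed
  have "real n / 4 \<le> 40960 * sqrt (p (gram (L l) (L l)))" for n
  proof -
    have "real n / 4 = 1/4 * (1/3) ^ n * (real n * 3 ^ n)"
      by (simp add: power_divide)
    also have "\<dots> \<le> 1/4 * (1/3) ^ n * S n"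
      using S_large[of n] by (intro mult_left_mono) auto
    also have "\<dots> \<le> t n l" by (rule t_limit)
    also have "\<dots> \<le> 40960 * sqrt (p (gram (u n) (u n))) * sqrt (p (gram (L l) (L l)))"
      unfolding t_def adj by (rule gram_cauchy_schwarz[OF cstar])
    also have "\<dots> \<le> 40960 * 1 * sqrt (p (gram (L l) (L l)))"
      using u(1)[of n] cstar by (intro mult_right_mono mult_left_mono) (auto simp: simultaneous_unit_ball_def)
    finally show ?thesis by simp
  qed
  thus False
    using reals_Archimedean2[of "4 * (40960 * sqrt (p (gram (L l) (L l))))"] by (metis linorder_not_less
      mult.commute pos_divide_le_eq zero_less_numeral)
qed

text \<open>For \<open>p [u, u] \<le> 1\<close> the vector \<open>u = u' (1 + [u, u]\<^sup>2)\<close> is the product of a vector \<open>u'\<close> in the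
simultaneous unit ball with a factor whose size with respect to \<open>p\<close> is bounded. The general case follows by scaling; the summand \<open>e > 0\<close> covers vectors with \<open>p [u, u] = 0\<close>.\<close>

lemma adjointable_bounded:
  assumes p: "p \<in> continuous_cstar_seminorms scaleA star T"
    and adj: "\<And>h k. gram (K h) k = gram h (L k)"
  shows "\<exists>C\<ge>0. \<forall>u. p (gram (K u) u) \<le> C * p (gram u u)"
proof -
  have cstar: "cstar_seminorm scaleA star p" using p by (simp add: continuous_cstar_seminorms_def)
  interpret cstar_seminormed_algebra scaleA star p using cstar by unfold_locales
  obtain M where M: "\<And>u. u \<in> simultaneous_unit_ball \<Longrightarrow> p (gram (K u) u) \<le> M"
    using adjointable_bounded_on_ball[OF assms] by blast
  have unit: "p (gram (K u) u) \<le> 85 * M" if le: "p (gram u u) \<le> 1" for u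
  proof -
    obtain u' where u': "u' \<in> simultaneous_unit_ball" "u = u' + act u' (gram u u * gram u u)"
      by (rule ex_simultaneously_bounded)
    define v where "v = gram u u * gram u u"
    have "star (gram u u) = gram u u" by (metis gram_star)
    hence v: "star v = v" "p v \<le> 1"
      using le selfadjoint_square[of "gram u u"] by (simp_all add: v_def star_mult power_le_one)
    have u: "u = u' + act u' v" using u'(2) unfolding v_def .
    define W where "W = gram (K u') u'"
    define Z where "Z = gram (K u') u"
    have Z: "Z = W + W * v"
      unfolding Z_def W_def by (subst u) (simp add: gram_add_right gram_act_right)
    have "gram (K u) u = gram (u' + act u' v) (L u)" using adj u by simp
    also have "\<dots> = Z + v * Z"
      by (simp add: gram_add_left gram_act_left v Z_def adj)
    finally have "p (gram (K u) u) \<le> p Z + 4 * p v * p Z"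
      using triangle[of Z "v * Z"] selfadjoint_mult_bound[OF v(1), of Z] by simp
    also have "4 * p v * p Z \<le> 4 * 1 * p Z"
      using v by (intro mult_right_mono mult_left_mono) auto
    finally have 1: "p (gram (K u) u) \<le> 5 * p Z" by simp
    have "p Z \<le> p W + 16 * p W * p v"
      unfolding Z using triangle[of W "W * v"] mult_bound[of W v] by simp
    also have "16 * p W * p v \<le> 16 * p W * 1"
      using v by (intro mult_left_mono) auto
    finally have "p Z \<le> 17 * p W" by simp
    with 1 M[OF u'(1)] show ?thesis by (simp add: W_def)
  qed
  have "85 * M \<ge> 0" using unit[of 0] p_nonneg[of "gram (K 0) 0"] by (simp del: p_nonneg)
  moreover have "p (gram (K u) u) \<le> 85 * M * p (gram u u)" for u
  proof -
    define a where "a = p (gram u u)"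
    have *: "p (gram (K u) u) \<le> 85 * M * (a + e)" if e: "e > 0" for e
    proof -
      have a: "a \<ge> 0" "a + e > 0" using e by (simp_all add: a_def add_nonneg_pos)
      define c where "c = 1 / sqrt (a + e)"
      have c: "c\<^sup>2 = 1 / (a + e)" using a by (simp add: c_def power_divide)
      let ?w = "scaleH (complex_of_real c) u"
      have scaled: "p (scaleA (complex_of_real c) (scaleA (complex_of_real c) b)) = c\<^sup>2 * p b" for b
        by (simp only: p_scale norm_of_real) (simp add: power2_eq_square)
      have "p (gram ?w ?w) = c\<^sup>2 * a"
        by (simp only: gram_scale_left gram_scale_right complex_cnj_complex_of_real scaled a_def)
      also have "\<dots> \<le> 1" unfolding c using a e by simp
      finally have "p (gram ?w ?w) \<le> 1" .
      hence "p (gram (K ?w) ?w) \<le> 85 * M" by (rule unit)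
      moreover have "gram (K ?w) ?w = scaleA (complex_of_real c) (scaleA (complex_of_real c) (gram (K u) u))"
        by (simp only: gram_scale_right) (simp only: adj gram_scale_left complex_cnj_complex_of_real)
      ultimately have "c\<^sup>2 * p (gram (K u) u) \<le> 85 * M" by (simp only: scaled)
      thus ?thesis using a unfolding c by (simp add: field_simps)
    qed
    have "p (gram (K u) u) \<le> 85 * M * a"
    proof (rule tendsto_lowerbound[where F = "at_right (0::real)" and f = "\<lambda>e. 85 * M * (a + e)"])
      have "((\<lambda>e. 85 * M * (a + e)) \<longlongrightarrow> 85 * M * (a + 0)) (at_right 0)" by (intro tendsto_intros)
      thus "((\<lambda>e. 85 * M * (a + e)) \<longlongrightarrow> 85 * M * a) (at_right 0)" by simp
      show "\<forall>\<^sub>F e in at_right 0. p (gram (K u) u) \<le> 85 * M * (a + e)"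
        using * by (intro eventually_at_rightI[of 0 1]) auto
    qed simp
    thus ?thesis by (simp add: a_def)
  qed
  ultimately show ?thesis by blast
qed

section \<open>Kernels\<close>

text \<open>Positivity of the kernel is applied to the points \<open>y\<^sub>1, \<dots>, y\<^sub>n, x\<close> with the vectors \<open>h\<^sub>1, \<dots>, h\<^sub>n, c u\<close>.\<close>

lemma kernel_cauchy_schwarz:
  fixes X :: "'x set" and y :: "nat \<Rightarrow> 'x" and h :: "nat \<Rightarrow> 'h"
  assumes cstar: "cstar_seminorm scaleA star p"
    and kernel: "positive_semidefinite_kernel star gram X k"
    and adj: "\<And>x y. x \<in> X \<Longrightarrow> y \<in> X \<Longrightarrow> k x y \<in> adjointable_operators scaleH gram"
    and x: "x \<in> X" and y: "\<And>i. i \<in> {1..n} \<Longrightarrow> y i \<in> X"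
  shows "(p (\<Sum>i=1..n. gram (k x (y i) (h i)) u))\<^sup>2
    \<le> 16 * 10240\<^sup>2 * p (\<Sum>i=1..n. \<Sum>j=1..n. gram (k (y i) (y j) (h j)) (h i)) * p (gram (k x x u) u)"
proof -
  interpret cstar_seminormed_algebra scaleA star p using cstar by unfold_locales
  let ?F = "\<Sum>i=1..n. \<Sum>j=1..n. gram (k (y i) (y j) (h j)) (h i)"
  let ?S = "\<Sum>i=1..n. gram (k x (y i) (h i)) u"
  let ?S' = "\<Sum>i=1..n. gram (k (y i) x u) (h i)"
  have scale: "k a b (scaleH c v) = scaleH c (k a b v)" if "a \<in> X" "b \<in> X" for a b c v
  proof -
    interpret kl: Vector_Spaces.linear scaleH scaleH "k a b"
      using adj[OF that] by (simp add: adjointable_operators_def)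
    show ?thesis by (rule kl.scale)
  qed
  show ?thesis
  proof (rule cauchy_schwarz_bound)
    fix c
    define y' where "y' = (\<lambda>i. if i \<le> n then y i else x)"
    define h' where "h' = (\<lambda>i. if i \<le> n then h i else scaleH c u)"
    have "\<forall>i\<in>{1..Suc n}. y' i \<in> X" using x y by (auto simp: y'_def)
    hence "positive star (\<Sum>i=1..Suc n. \<Sum>j=1..Suc n. gram (k (y' i) (y' j) (h' j)) (h' i))"
      using kernel unfolding positive_semidefinite_kernel_def by blast
    also have "(\<Sum>i=1..Suc n. \<Sum>j=1..Suc n. gram (k (y' i) (y' j) (h' j)) (h' i))
        = (\<Sum>i=1..n. (\<Sum>j=1..n. gram (k (y i) (y j) (h j)) (h i)) + gram (k (y i) x (scaleH c u)) (h i))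
          + ((\<Sum>j=1..n. gram (k x (y j) (h j)) (scaleH c u)) + gram (k x x (scaleH c u)) (scaleH c u))"
      by (simp add: y'_def h'_def)
    also have "\<dots> = ?F + scaleA c ?S + scaleA (cnj c) ?S' + scaleA (c * cnj c) (gram (k x x u) u)"
      by (simp add: scale x y gram_scale_left gram_scale_right sum.distrib scale_sum_right add_ac)
    finally show "positive star (?F + scaleA c ?S + scaleA (cnj c) ?S' + scaleA (c * cnj c) (gram (k x x u) u))" .
  qed
qed

end

theorem lemma3p1:
  fixes scaleA :: "complex \<Rightarrow> 'a::ring \<Rightarrow> 'a" and star :: "'a \<Rightarrow> 'a" and T :: "'a topology"
    and scaleH :: "complex \<Rightarrow> 'h::ab_group_add \<Rightarrow> 'h"
    and act :: "'h \<Rightarrow> 'a \<Rightarrow> 'h" and gram :: "'h \<Rightarrow> 'h \<Rightarrow> 'a"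
    and X :: "'x set" and k :: "'x \<Rightarrow> 'x \<Rightarrow> 'h \<Rightarrow> 'h"
  assumes "locally_cstar_algebra scaleA star T"
    and "hilbert_module scaleA star T scaleH act gram"
    and "X \<noteq> {}"
    and "\<And>x y. x \<in> X \<Longrightarrow> y \<in> X \<Longrightarrow> k x y \<in> adjointable_operators scaleH gram"
    and "positive_semidefinite_kernel star gram X k"
  shows "\<forall>p \<in> continuous_cstar_seminorms scaleA star T. \<forall>x \<in> X. \<exists>c::real. c \<ge> 0 \<and>
    (\<forall>(n::nat) (y :: nat \<Rightarrow> 'x) (h :: nat \<Rightarrow> 'h). (\<forall>i\<in>{1..n}. y i \<in> X) \<longrightarrow>
      p (\<Sum>i=1..n. \<Sum>j=1..n. gram (k x (y i) (h i)) (k x (y j) (h j)))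
        \<le> c * p (\<Sum>i=1..n. \<Sum>j=1..n. gram (k (y j) (y i) (h i)) (h j)))"
proof (intro ballI)
  fix p x assume p: "p \<in> continuous_cstar_seminorms scaleA star T" and x: "x \<in> X"
  interpret hilbert_module scaleA star T scaleH act gram by (rule assms(2))
  have cstar: "cstar_seminorm scaleA star p" using p by (simp add: continuous_cstar_seminorms_def)
  interpret cstar_seminormed_algebra scaleA star p using cstar by unfold_locales
  obtain L where "\<And>h e. gram (k x x h) e = gram h (L e)"
    using assms(4)[OF x x] unfolding adjointable_operators_def by blast
  from adjointable_bounded[OF p this] obtain C where
    C: "C \<ge> 0" "\<And>u. p (gram (k x x u) u) \<le> C * p (gram u u)" by blast
  define D :: real where "D = 16 * 10240\<^sup>2"
  show "\<exists>c::real. c \<ge> 0 \<and>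
    (\<forall>(n::nat) (y :: nat \<Rightarrow> 'x) (h :: nat \<Rightarrow> 'h). (\<forall>i\<in>{1..n}. y i \<in> X) \<longrightarrow>
      p (\<Sum>i=1..n. \<Sum>j=1..n. gram (k x (y i) (h i)) (k x (y j) (h j)))
        \<le> c * p (\<Sum>i=1..n. \<Sum>j=1..n. gram (k (y j) (y i) (h i)) (h j)))"
  proof (intro exI[of _ "D * C"] conjI allI impI)
    show "0 \<le> D * C" using C by (simp add: D_def)
  next
    fix n and y :: "nat \<Rightarrow> 'x" and h :: "nat \<Rightarrow> 'h" assume y: "\<forall>i\<in>{1..n}. y i \<in> X"
    let ?F = "\<Sum>i=1..n. \<Sum>j=1..n. gram (k (y i) (y j) (h j)) (h i)"
    define u where "u = (\<Sum>i=1..n. k x (y i) (h i))"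
    have lhs: "(\<Sum>i=1..n. \<Sum>j=1..n. gram (k x (y i) (h i)) (k x (y j) (h j))) = gram u u"
      by (simp only: u_def gram_sum_left) (simp only: gram_sum_right)
    have rhs: "(\<Sum>i=1..n. \<Sum>j=1..n. gram (k (y j) (y i) (h i)) (h j)) = ?F" by (rule sum.swap)
    have "(p (gram u u))\<^sup>2 \<le> D * p ?F * p (gram (k x x u) u)"
      using kernel_cauchy_schwarz[OF cstar assms(5,4) x, of n y h u] y
      by (simp add: D_def u_def gram_sum_left)
    also have "\<dots> \<le> D * p ?F * (C * p (gram u u))"
      by (intro mult_left_mono C) (simp add: D_def)
    finally have "p (gram u u) * p (gram u u) \<le> (D * C * p ?F) * p (gram u u)"
      by (simp add: power2_eq_square mult_ac)
    hence "p (gram u u) \<le> D * C * p ?F"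
      using C p_nonneg[of "gram u u"] p_nonneg[of ?F] D_def
      by (cases "p (gram u u) = 0") auto
    thus "p (\<Sum>i=1..n. \<Sum>j=1..n. gram (k x (y i) (h i)) (k x (y j) (h j)))
        \<le> D * C * p (\<Sum>i=1..n. \<Sum>j=1..n. gram (k (y j) (y i) (h i)) (h j))"
      unfolding lhs rhs .
  qed
qed

end
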